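(* The category $\mathbb{ME}$ of modal Esakia spaces with ME-morphisms and the category $\mathbb{MH}$ of modal Heyting algebras with modal Heyting algebra homomorphisms are dually equivalent.
   Context: A modal Heyting algebra is $\langle\mathbf{H},\Box,\Diamond\rangle$ with $\mathbf{H}$ a Heyting algebra and unary $\Box,\Diamond$ satisfying $\Box a\wedge\Diamond(-a\wedge b)=\bot$ for all $a,b$, where $-a=a\rightharpoonup\bot$; homomorphisms preserve the Heyting operations and $\Box,\Diamond$. An Esakia space is a compact ordered space $\langle X,\tau,\le\rangle$ such that if $x\not\le y$ there is a clopen up-set containing $x$ but not $y$, and ${\downarrow}U$ is clopen for every clopen $U$; $\mathcal{U}(X)$, $\mathcal{D}(X)$ denote clopen up-sets and clopen down-sets. A modal Esakia space is $\langle X,\tau,\le,\eta_1,\eta_2\rangle$ with $\langle X,\tau,\le\rangle$ an Esakia space and $\eta_1,\eta_2\colon X\to\mathcal{P}(\mathcal{P}(X))$ such that for all $x\in X$ and $U,V\in\mathcal{U}(X)$: (1) $\eta_1(x)\subseteq\mathcal{U}(X)$ and $\eta_2(x)\subseteq\mathcal{D}(X)$; (2) $\Box_{\eta_1}(U)=\{x: U\in\eta_1(x)\}$ and $\Diamond_{\eta_2}(U)=\{x: X\setminus U\notin\eta_2(x)\}$ are clopen up-sets; (3) if $U\in\eta_1(x)$ then ${\downarrow}U\cup(X\setminus V)\in\eta_2(x)$. An Esakia function is continuous, order-preserving and satisfies ${\uparrow}f(x)\subseteq f[{\uparrow}x]$. An ME-morphism $f\colon X_1\to X_2$ between modal Esakia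 spaces $\langle X_1,\tau_1,\le_1,\eta_1,\eta_2\rangle$, $\langle X_2,\tau_2,\le_2,\eta'_1,\eta'_2\rangle$ is an Esakia function such that for every $x\in X_1$ and $U\in\mathcal{U}(X_2)$: $U\in\eta'_1(f(x))$ iff $f^{-1}[U]\in\eta_1(x)$, and $X_2\setminus U\in\eta'_2(f(x))$ iff $X_1\setminus f^{-1}[U]\in\eta_2(x)$. *)

theory Defs
  imports "HOL-Analysis.Analysis" "HOL-Algebra.Lattice"
begin

section \<open>Categories\<close>

text \<open>
  Hom-sets need not be disjoint, so composition, the action of a functor on arrows and
  naturality all mention the source and target objects explicitly.
  \<open>Cmp C X Y Z g f\<close> is the composite of \<open>f: X \<rightarrow> Y\<close> followed by \<open>g: Y \<rightarrow> Z\<close>.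
\<close>

record ('o, 'm) cat =
  Ob :: "'o set"
  Hom :: "'o \<Rightarrow> 'o \<Rightarrow> 'm set"
  Idt :: "'o \<Rightarrow> 'm"
  Cmp :: "'o \<Rightarrow> 'o \<Rightarrow> 'o \<Rightarrow> 'm \<Rightarrow> 'm \<Rightarrow> 'm"

locale category =
  fixes C :: "('o, 'm) cat"
  assumes Idt_Hom: "X \<in> Ob C \<Longrightarrow> Idt C X \<in> Hom C X X"
    and Cmp_Hom: "\<lbrakk>X \<in> Ob C; Y \<in> Ob C; Z \<in> Ob C; f \<in> Hom C X Y; g \<in> Hom C Y Z\<rbrakk>
      \<Longrightarrow> Cmp C X Y Z g f \<in> Hom C X Z"
    and Cmp_Idt_right: "\<lbrakk>X \<in> Ob C; Y \<in> Ob C; f \<in> Hom C X Y\<rbrakk> \<Longrightarrow> Cmp C X X Y f (Idt C X) = f"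
    and Cmp_Idt_left: "\<lbrakk>X \<in> Ob C; Y \<in> Ob C; f \<in> Hom C X Y\<rbrakk> \<Longrightarrow> Cmp C X Y Y (Idt C Y) f = f"
    and Cmp_assoc: "\<lbrakk>W \<in> Ob C; X \<in> Ob C; Y \<in> Ob C; Z \<in> Ob C;
        f \<in> Hom C W X; g \<in> Hom C X Y; h \<in> Hom C Y Z\<rbrakk>
      \<Longrightarrow> Cmp C W X Z (Cmp C X Y Z h g) f = Cmp C W Y Z h (Cmp C W X Y g f)"

definition opposite :: "('o, 'm) cat \<Rightarrow> ('o, 'm) cat" where
  "opposite C = \<lparr> Ob = Ob C,
                  Hom = (\<lambda>X Y. Hom C Y X),
                  Idt = Idt C,
                  Cmp = (\<lambda>X Y Z g f. Cmp C Z Y X f g) \<rparr>"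

definition cat_iso :: "('o, 'm) cat \<Rightarrow> 'o \<Rightarrow> 'o \<Rightarrow> 'm \<Rightarrow> bool" where
  "cat_iso C X Y f \<longleftrightarrow> f \<in> Hom C X Y \<and>
     (\<exists>g \<in> Hom C Y X. Cmp C X Y X g f = Idt C X \<and> Cmp C Y X Y f g = Idt C Y)"

record ('o, 'm, 'p, 'n) cat_map =
  on_Ob :: "'o \<Rightarrow> 'p"
  on_Hom :: "'o \<Rightarrow> 'o \<Rightarrow> 'm \<Rightarrow> 'n"

locale cat_functor =
  source: category C + target: category D
  for C :: "('o, 'm) cat" and D :: "('p, 'n) cat" +
  fixes F :: "('o, 'm, 'p, 'n) cat_map"
  assumes on_Ob: "X \<in> Ob C \<Longrightarrow> on_Ob F X \<in> Ob D"
    and on_Hom: "\<lbrakk>X \<in> Ob C; Y \<in> Ob C; f \<in> Hom C X Y\<rbrakk>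
      \<Longrightarrow> on_Hom F X Y f \<in> Hom D (on_Ob F X) (on_Ob F Y)"
    and on_Idt: "X \<in> Ob C \<Longrightarrow> on_Hom F X X (Idt C X) = Idt D (on_Ob F X)"
    and on_Cmp: "\<lbrakk>X \<in> Ob C; Y \<in> Ob C; Z \<in> Ob C; f \<in> Hom C X Y; g \<in> Hom C Y Z\<rbrakk>
      \<Longrightarrow> on_Hom F X Z (Cmp C X Y Z g f) =
          Cmp D (on_Ob F X) (on_Ob F Y) (on_Ob F Z) (on_Hom F Y Z g) (on_Hom F X Y f)"

definition id_map :: "('o, 'm, 'o, 'm) cat_map" where
  "id_map = \<lparr> on_Ob = (\<lambda>X. X), on_Hom = (\<lambda>X Y f. f) \<rparr>"

definition comp_map ::
  "('p, 'n, 'q, 'k) cat_map \<Rightarrow> ('o, 'm, 'p, 'n) cat_map \<Rightarrow> ('o, 'm, 'q, 'k) cat_map" where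
  "comp_map G F = \<lparr> on_Ob = (\<lambda>X. on_Ob G (on_Ob F X)),
                    on_Hom = (\<lambda>X Y f. on_Hom G (on_Ob F X) (on_Ob F Y) (on_Hom F X Y f)) \<rparr>"

definition natural_iso ::
  "('o, 'm) cat \<Rightarrow> ('p, 'n) cat \<Rightarrow> ('o, 'm, 'p, 'n) cat_map \<Rightarrow> ('o, 'm, 'p, 'n) cat_map
    \<Rightarrow> ('o \<Rightarrow> 'n) \<Rightarrow> bool" where
  "natural_iso C D F G \<eta> \<longleftrightarrow>
     (\<forall>X \<in> Ob C. cat_iso D (on_Ob F X) (on_Ob G X) (\<eta> X)) \<and>
     (\<forall>X \<in> Ob C. \<forall>Y \<in> Ob C. \<forall>f \<in> Hom C X Y.
        Cmp D (on_Ob F X) (on_Ob F Y) (on_Ob G Y) (\<eta> Y) (on_Hom F X Y f) =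
        Cmp D (on_Ob F X) (on_Ob G X) (on_Ob G Y) (on_Hom G X Y f) (\<eta> X))"

definition equivalent_categories :: "('o, 'm) cat \<Rightarrow> ('p, 'n) cat \<Rightarrow> bool" where
  "equivalent_categories C D \<longleftrightarrow>
     (\<exists>F G \<eta> \<epsilon>. cat_functor C D F \<and> cat_functor D C G \<and>
        natural_iso C C id_map (comp_map G F) \<eta> \<and>
        natural_iso D D (comp_map F G) id_map \<epsilon>)"

definition dually_equivalent :: "('o, 'm) cat \<Rightarrow> ('p, 'n) cat \<Rightarrow> bool" where
  "dually_equivalent C D \<longleftrightarrow> equivalent_categories C (opposite D)"

lemma category_opposite:
  assumes "category C"
  shows "category (opposite C)"
proof -
  interpret category C by fact
  show ?thesis
    by unfold_locales
      (simp_all add: opposite_def Idt_Hom Cmp_Hom Cmp_Idt_left Cmp_Idt_right Cmp_assoc)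
qed


section \<open>Modal Heyting algebras\<close>

record 'a modal_heyting = "'a gorder" +
  imp :: "'a \<Rightarrow> 'a \<Rightarrow> 'a"
  box :: "'a \<Rightarrow> 'a"
  dia :: "'a \<Rightarrow> 'a"

definition neg :: "('a, 'e) modal_heyting_scheme \<Rightarrow> 'a \<Rightarrow> 'a" where
  "neg H a = imp H a \<bottom>\<^bsub>H\<^esub>"

locale heyting_algebra =
  Lattice.bounded_lattice H for H :: "('a, 'e) modal_heyting_scheme" (structure) +
  assumes imp_closed: "\<lbrakk>a \<in> carrier H; b \<in> carrier H\<rbrakk> \<Longrightarrow> imp H a b \<in> carrier H"
    and imp_residual: "\<lbrakk>a \<in> carrier H; b \<in> carrier H; c \<in> carrier H\<rbrakk>
      \<Longrightarrow> c \<sqinter>\<^bsub>H\<^esub> a \<sqsubseteq>\<^bsub>H\<^esub> b \<longleftrightarrow> c \<sqsubseteq>\<^bsub>H\<^esub> imp H a b"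

locale modal_heyting_algebra =
  heyting_algebra H for H :: "('a, 'e) modal_heyting_scheme" (structure) +
  assumes box_closed: "a \<in> carrier H \<Longrightarrow> box H a \<in> carrier H"
    and dia_closed: "a \<in> carrier H \<Longrightarrow> dia H a \<in> carrier H"
    and box_dia: "\<lbrakk>a \<in> carrier H; b \<in> carrier H\<rbrakk>
      \<Longrightarrow> box H a \<sqinter>\<^bsub>H\<^esub> dia H (neg H a \<sqinter>\<^bsub>H\<^esub> b) = \<bottom>\<^bsub>H\<^esub>"

text \<open>
  Here and below arrows are functions on the carrier, represented by functions that are
  \<open>undefined\<close> elsewhere (\<^const>\<open>extensional\<close>), so that equality of arrows is equality on the carrier.
\<close>

definition mh_hom :: "'a modal_heyting \<Rightarrow> 'a modal_heyting \<Rightarrow> ('a \<Rightarrow> 'a) set" where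
  "mh_hom H K = {f \<in> carrier H \<rightarrow>\<^sub>E carrier K.
     f \<bottom>\<^bsub>H\<^esub> = \<bottom>\<^bsub>K\<^esub> \<and> f \<top>\<^bsub>H\<^esub> = \<top>\<^bsub>K\<^esub> \<and>
     (\<forall>a \<in> carrier H. \<forall>b \<in> carrier H.
        f (a \<sqinter>\<^bsub>H\<^esub> b) = f a \<sqinter>\<^bsub>K\<^esub> f b \<and>
        f (a \<squnion>\<^bsub>H\<^esub> b) = f a \<squnion>\<^bsub>K\<^esub> f b \<and>
        f (imp H a b) = imp K (f a) (f b)) \<and>
     (\<forall>a \<in> carrier H. f (box H a) = box K (f a) \<and> f (dia H a) = dia K (f a))}"


section \<open>Modal Esakia spaces\<close>

text \<open>The point set is the \<^const>\<open>topspace\<close> of the topology; the order is a set of pairs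
  \<open>(x, y)\<close> with \<open>x \<le> y\<close>.\<close>

record 'p modal_esakia =
  tau :: "'p topology"
  ord :: "('p \<times> 'p) set"
  eta1 :: "'p \<Rightarrow> 'p set set"
  eta2 :: "'p \<Rightarrow> 'p set set"

abbreviation points :: "('p, 'e) modal_esakia_scheme \<Rightarrow> 'p set" where
  "points X \<equiv> topspace (tau X)"

definition up :: "('p, 'e) modal_esakia_scheme \<Rightarrow> 'p set \<Rightarrow> 'p set" where
  "up X S = {y \<in> points X. \<exists>x \<in> S. (x, y) \<in> ord X}"

definition down :: "('p, 'e) modal_esakia_scheme \<Rightarrow> 'p set \<Rightarrow> 'p set" where
  "down X S = {x \<in> points X. \<exists>y \<in> S. (x, y) \<in> ord X}"

definition clopens :: "('p, 'e) modal_esakia_scheme \<Rightarrow> 'p set set" where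
  "clopens X = {U. openin (tau X) U \<and> closedin (tau X) U}"

definition clopen_upsets :: "('p, 'e) modal_esakia_scheme \<Rightarrow> 'p set set" where
  "clopen_upsets X = {U \<in> clopens X. up X U \<subseteq> U}"

definition clopen_downsets :: "('p, 'e) modal_esakia_scheme \<Rightarrow> 'p set set" where
  "clopen_downsets X = {U \<in> clopens X. down X U \<subseteq> U}"

locale esakia_space =
  fixes X :: "('p, 'e) modal_esakia_scheme"
  assumes order: "partial_order_on (points X) (ord X)"
    and compact: "compact_space (tau X)"
    and separation: "\<lbrakk>x \<in> points X; y \<in> points X; (x, y) \<notin> ord X\<rbrakk>
      \<Longrightarrow> \<exists>U \<in> clopen_upsets X. x \<in> U \<and> y \<notin> U"
    and down_clopen: "U \<in> clopens X \<Longrightarrow> down X U \<in> clopens X"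

definition box_of :: "('p, 'e) modal_esakia_scheme \<Rightarrow> 'p set \<Rightarrow> 'p set" where
  "box_of X U = {x \<in> points X. U \<in> eta1 X x}"

definition dia_of :: "('p, 'e) modal_esakia_scheme \<Rightarrow> 'p set \<Rightarrow> 'p set" where
  "dia_of X U = {x \<in> points X. points X - U \<notin> eta2 X x}"

locale modal_esakia_space =
  esakia_space X for X :: "('p, 'e) modal_esakia_scheme" +
  assumes eta1_upsets: "x \<in> points X \<Longrightarrow> eta1 X x \<subseteq> clopen_upsets X"
    and eta2_downsets: "x \<in> points X \<Longrightarrow> eta2 X x \<subseteq> clopen_downsets X"
    and box_of_clopen: "U \<in> clopen_upsets X \<Longrightarrow> box_of X U \<in> clopen_upsets X"
    and dia_of_clopen: "U \<in> clopen_upsets X \<Longrightarrow> dia_of X U \<in> clopen_upsets X"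
    and eta1_eta2: "\<lbrakk>x \<in> points X; U \<in> clopen_upsets X; V \<in> clopen_upsets X; U \<in> eta1 X x\<rbrakk>
      \<Longrightarrow> down X U \<union> (points X - V) \<in> eta2 X x"

definition esakia_functions :: "'p modal_esakia \<Rightarrow> 'p modal_esakia \<Rightarrow> ('p \<Rightarrow> 'p) set" where
  "esakia_functions X Y = {f \<in> points X \<rightarrow>\<^sub>E points Y.
     continuous_map (tau X) (tau Y) f \<and>
     (\<forall>x y. (x, y) \<in> ord X \<longrightarrow> (f x, f y) \<in> ord Y) \<and>
     (\<forall>x \<in> points X. up Y {f x} \<subseteq> f ` up X {x})}"

definition me_hom :: "'p modal_esakia \<Rightarrow> 'p modal_esakia \<Rightarrow> ('p \<Rightarrow> 'p) set" where
  "me_hom X Y = {f \<in> esakia_functions X Y.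
     \<forall>x \<in> points X. \<forall>U \<in> clopen_upsets Y.
       (U \<in> eta1 Y (f x) \<longleftrightarrow> f -` U \<inter> points X \<in> eta1 X x) \<and>
       (points Y - U \<in> eta2 Y (f x) \<longleftrightarrow> points X - f -` U \<in> eta2 X x)}"


section \<open>The two categories\<close>

text \<open>
  There is no type of all sets, so the objects of a category have to live on subsets of a fixed
  type and the dual of a structure has to fit into the type of the other category. The sizes of
  structures are therefore controlled by a family \<open>\<V>\<close> of sets playing the role of a universe:
  a set is \<open>\<V>\<close>-small if it injects into a member of \<open>\<V>\<close>.
\<close>

definition small :: "'v set set \<Rightarrow> 's set \<Rightarrow> bool" where
  "small \<V> S \<longleftrightarrow> (\<exists>V \<in> \<V>. S \<lesssim> V)"

definition MH :: "'a set set \<Rightarrow> ('a modal_heyting, 'a \<Rightarrow> 'a) cat" where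
  "MH \<A> = \<lparr> Ob = {H. modal_heyting_algebra H \<and> small \<A> (carrier H)},
            Hom = mh_hom,
            Idt = (\<lambda>H. restrict id (carrier H)),
            Cmp = (\<lambda>H K L g f. compose (carrier H) g f) \<rparr>"

text \<open>
  The size of a space is measured by its points and by its clopen up-sets, the latter forming
  the underlying set of the dual algebra.
\<close>

definition ME :: "'p set set \<Rightarrow> 'a set set \<Rightarrow> ('p modal_esakia, 'p \<Rightarrow> 'p) cat" where
  "ME \<P> \<A> = \<lparr> Ob = {X. modal_esakia_space X \<and> small \<P> (points X) \<and> small \<A> (clopen_upsets X)},
              Hom = me_hom,
              Idt = (\<lambda>X. restrict id (points X)),
              Cmp = (\<lambda>X Y Z g f. compose (points X) g f) \<rparr>"

text \<open>
  If power sets of \<open>\<P>\<close>-small sets are \<open>\<A>\<close>-small, for instance if \<open>\<A> = \<P>\<close> is closed under power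
  sets up to bijection, the condition on clopen up-sets is redundant.
\<close>

lemma clopen_upsets_subset_Pow: "clopen_upsets X \<subseteq> Pow (points X)"
  by (auto simp: clopen_upsets_def clopens_def dest: openin_subset)

lemma Ob_ME_power_closed:
  assumes "\<And>P. P \<in> \<P> \<Longrightarrow> small \<A> (Pow P)"
  shows "Ob (ME \<P> \<A>) = {X. modal_esakia_space X \<and> small \<P> (points X)}"
proof -
  have "small \<A> (clopen_upsets X)" if "small \<P> (points X)" for X :: "'a modal_esakia"
  proof -
    obtain P where P: "P \<in> \<P>" "points X \<lesssim> P"
      using \<open>small \<P> (points X)\<close> by (auto simp: small_def)
    obtain A where A: "A \<in> \<A>" "Pow P \<lesssim> A"
      using assms[OF P(1)] by (auto simp: small_def)
    have "clopen_upsets X \<lesssim> Pow (points X)"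
      by (rule subset_imp_lepoll[OF clopen_upsets_subset_Pow])
    also have "Pow (points X) \<lesssim> Pow P"
      using P(2) unfolding lepoll_def by (blast intro: inj_on_image_Pow image_Pow_mono)
    also note A(2)
    finally show ?thesis
      using A(1) by (auto simp: small_def)
  qed
  then show ?thesis
    by (auto simp: ME_def)
qed

text \<open>
  With \<open>\<A> = {UNIV}\<close> all algebras on subsets of the type are objects. A given space becomes an object
  once the type is large enough to accommodate its clopen up-sets.
\<close>

lemma Ob_MH_UNIV: "Ob (MH {UNIV}) = {H. modal_heyting_algebra H}"
  by (auto simp: MH_def small_def intro: subset_imp_lepoll)

lemma Ob_ME_UNIV:
  "Ob (ME {UNIV :: 'p set} {UNIV :: 'a set}) =
     {X. modal_esakia_space X \<and> clopen_upsets X \<lesssim> (UNIV :: 'a set)}"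
  by (auto simp: ME_def small_def intro: subset_imp_lepoll)

lemma small_Pow_UNIV:
  fixes A :: "'a set"
  shows "small {UNIV :: 'a set set} (Pow A)"
  by (auto simp: small_def intro: subset_imp_lepoll)

end

theory Submission
  imports Defs
begin

text \<open>
  A modal Esakia space is sent to the algebra of its clopen up-sets and a morphism to its inverse
  image map. This functor is fully faithful: given a homomorphism \<open>h\<close> from the clopen up-sets of
  \<open>Y\<close> to those of \<open>X\<close>, compactness of \<open>Y\<close> yields for each \<open>x\<close> a unique point \<open>y\<close> lying
  in exactly those \<open>U\<close> with \<open>x \<in> h U\<close>, and compactness of \<open>X\<close> makes \<open>x \<mapsto> y\<close> an
  Esakia function; the neighbourhood conditions on morphisms then say that \<open>h\<close> preserves box and
  diamond. It is essentially surjective: an algebra \<open>H\<close> is the algebra of clopen up-sets of its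
  space of prime filters, with \<open>\<eta>\<^sub>1\<close> and \<open>\<eta>\<^sub>2\<close> read off from \<open>\<box> a \<in> x\<close>
  and \<open>\<diamond> a \<notin> x\<close>.
\<close>

section \<open>Equivalences from fully faithful functors\<close>

text \<open>The dual of a space has to be an algebra on a subset of \<open>'a\<close>, while clopen
  up-sets are sets of points; the functor therefore transports them along an injection chosen once
  for each space. Working with full faithfulness and essential surjectivity means that the spectrum
  is studied one algebra at a time, and that the inverse functor comes from choice. The two
  conditions linking box and diamond match because the union of the down-set of \<open>U\<close>
  with the complement of \<open>V\<close> is the complement of the meet of \<open>-U\<close> and
  \<open>V\<close>. On the side of morphisms, preservation of implication is what becomes the back
  condition of Esakia functions. Compactness of a space is used through directed open covers, of
  which a single member already covers; statements about all points thereby turn into one inclusion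
  between clopen sets.\<close>

lemma cat_iso_Hom: "cat_iso C X Y f \<Longrightarrow> f \<in> Hom C X Y"
  by (simp add: cat_iso_def)

text \<open>Fullness lifts the inverse arrow to \<open>C\<close>; faithfulness pulls the two inverse
  laws back, since they hold after applying \<open>F\<close>.\<close>

lemma (in category) fully_faithful_reflects_iso:
  assumes F: "cat_functor C D F"
    and bij: "\<And>X Y. \<lbrakk>X \<in> Ob C; Y \<in> Ob C\<rbrakk>
      \<Longrightarrow> bij_betw (on_Hom F X Y) (Hom C X Y) (Hom D (on_Ob F X) (on_Ob F Y))"
    and X: "X \<in> Ob C" and Y: "Y \<in> Ob C" and f: "f \<in> Hom C X Y"
    and iso: "cat_iso D (on_Ob F X) (on_Ob F Y) (on_Hom F X Y f)"
  shows "cat_iso C X Y f"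
proof -
  interpret F: cat_functor C D F by fact
  obtain g' where g': "g' \<in> Hom D (on_Ob F Y) (on_Ob F X)"
    "Cmp D (on_Ob F X) (on_Ob F Y) (on_Ob F X) g' (on_Hom F X Y f) = Idt D (on_Ob F X)"
    "Cmp D (on_Ob F Y) (on_Ob F X) (on_Ob F Y) (on_Hom F X Y f) g' = Idt D (on_Ob F Y)"
    using iso by (auto simp: cat_iso_def)
  obtain g where g: "g \<in> Hom C Y X" "on_Hom F Y X g = g'"
    using g'(1) unfolding bij_betw_imp_surj_on[OF bij[OF Y X], symmetric] by (elim imageE) simp
  have inj: "inj_on (on_Hom F Z Z) (Hom C Z Z)" if "Z \<in> Ob C" for Z
    using bij_betw_imp_inj_on[OF bij[OF that that]] .
  have "Cmp C X Y X g f = Idt C X"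
    by (rule inj_onD[OF inj[OF X]])
      (use X Y f g g' in \<open>simp_all add: F.on_Cmp F.on_Idt Cmp_Hom Idt_Hom\<close>)
  moreover have "Cmp C Y X Y f g = Idt C Y"
    by (rule inj_onD[OF inj[OF Y]])
      (use X Y f g g' in \<open>simp_all add: F.on_Cmp F.on_Idt Cmp_Hom Idt_Hom\<close>)
  ultimately show ?thesis
    using f g(1) by (auto simp: cat_iso_def)
qed

text \<open>Choose for each \<open>Z\<close> an object \<open>G0 Z\<close> and an isomorphism
  \<open>e Z\<close> with inverse \<open>d Z\<close>. The inverse functor conjugates an arrow by
  these isomorphisms and takes its preimage under \<open>F\<close>; \<open>e\<close> is then the
  counit, and the unit is the preimage of \<open>d\<close>.\<close>

lemma equivalent_categoriesI:
  assumes F: "cat_functor C D F"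
    and bij: "\<And>X Y. \<lbrakk>X \<in> Ob C; Y \<in> Ob C\<rbrakk>
      \<Longrightarrow> bij_betw (on_Hom F X Y) (Hom C X Y) (Hom D (on_Ob F X) (on_Ob F Y))"
    and surj: "\<And>Z. Z \<in> Ob D \<Longrightarrow> \<exists>X \<in> Ob C. \<exists>e. cat_iso D (on_Ob F X) Z e"
  shows "equivalent_categories C D"
proof -
  interpret F: cat_functor C D F by fact
  let ?F = "on_Ob F"
  note C = F.source.Cmp_Hom F.source.Idt_Hom
  note D = F.target.Cmp_Hom F.target.Idt_Hom
  obtain G0 e where G0: "\<And>Z. Z \<in> Ob D \<Longrightarrow> G0 Z \<in> Ob C"
    and e: "\<And>Z. Z \<in> Ob D \<Longrightarrow> cat_iso D (?F (G0 Z)) Z (e Z)"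
    using surj by metis
  have FG0: "\<And>Z. Z \<in> Ob D \<Longrightarrow> ?F (G0 Z) \<in> Ob D"
    by (simp add: G0 F.on_Ob)
  have "\<exists>d. d \<in> Hom D Z (?F (G0 Z)) \<and>
      Cmp D (?F (G0 Z)) Z (?F (G0 Z)) d (e Z) = Idt D (?F (G0 Z)) \<and>
      Cmp D Z (?F (G0 Z)) Z (e Z) d = Idt D Z" if "Z \<in> Ob D" for Z
    using e[OF that] by (auto simp: cat_iso_def)
  then obtain d where d: "\<And>Z. Z \<in> Ob D \<Longrightarrow> d Z \<in> Hom D Z (?F (G0 Z))"
    and de: "\<And>Z. Z \<in> Ob D \<Longrightarrow> Cmp D (?F (G0 Z)) Z (?F (G0 Z)) (d Z) (e Z) = Idt D (?F (G0 Z))"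
    and ed: "\<And>Z. Z \<in> Ob D \<Longrightarrow> Cmp D Z (?F (G0 Z)) Z (e Z) (d Z) = Idt D Z"
    by metis
  have eH: "\<And>Z. Z \<in> Ob D \<Longrightarrow> e Z \<in> Hom D (?F (G0 Z)) Z"
    using e cat_iso_Hom by metis
  have cancel_de: "Cmp D W (?F (G0 Z)) Z (e Z) (Cmp D W Z (?F (G0 Z)) (d Z) h) = h"
    if "W \<in> Ob D" "Z \<in> Ob D" "h \<in> Hom D W Z" for W Z h
    using that by (simp add: F.target.Cmp_assoc[symmetric] FG0 d eH ed F.target.Cmp_Idt_left)
  define pre where "pre X Y = inv_into (Hom C X Y) (on_Hom F X Y)" for X Y
  have pre_Hom: "pre X Y h \<in> Hom C X Y" and F_pre: "on_Hom F X Y (pre X Y h) = h"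
    if "X \<in> Ob C" "Y \<in> Ob C" "h \<in> Hom D (?F X) (?F Y)" for X Y h
    using bij[OF that(1,2)] that(3) unfolding pre_def
    by (auto simp: bij_betw_def intro: inv_into_into f_inv_into_f)
  \<comment> \<open>Faithfulness: equations between arrows of \<open>C\<close> are checked after
    applying \<open>F\<close>, where \<open>F_pre\<close> computes the chosen preimages.\<close>
  have eqI: "f = g" if "X \<in> Ob C" "Y \<in> Ob C" "f \<in> Hom C X Y" "g \<in> Hom C X Y"
    "on_Hom F X Y f = on_Hom F X Y g" for X Y f g
    using bij_betw_imp_inj_on[OF bij[OF that(1,2)]] that(3-5) by (auto dest: inj_onD)
  \<comment> \<open>\<open>F\<close> can be inverted only on arrows between objects in its image, so
    \<open>g\<close> is first moved to the chosen representatives.\<close>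
  define conj where "conj Z W g = Cmp D (?F (G0 Z)) W (?F (G0 W)) (d W) (Cmp D (?F (G0 Z)) Z W g (e Z))"
    for Z W g
  have conj_Hom: "conj Z W g \<in> Hom D (?F (G0 Z)) (?F (G0 W))"
    if "Z \<in> Ob D" "W \<in> Ob D" "g \<in> Hom D Z W" for Z W g
    unfolding conj_def using that FG0 d eH by (intro D) auto
  define G where "G = \<lparr> on_Ob = G0, on_Hom = (\<lambda>Z W g. pre (G0 Z) (G0 W) (conj Z W g)) \<rparr>"
  define \<eta> where "\<eta> X = pre X (G0 (?F X)) (d (?F X))" for X
  have FG: "on_Hom F (G0 Z) (G0 W) (pre (G0 Z) (G0 W) (conj Z W g)) = conj Z W g"
    if "Z \<in> Ob D" "W \<in> Ob D" "g \<in> Hom D Z W" for Z W g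
    using that by (intro F_pre G0 conj_Hom)
  have \<eta>_Hom: "\<eta> X \<in> Hom C X (G0 (?F X))" and F\<eta>: "on_Hom F X (G0 (?F X)) (\<eta> X) = d (?F X)"
    if "X \<in> Ob C" for X
    unfolding \<eta>_def using that by (auto intro!: pre_Hom F_pre G0 d F.on_Ob)
  have G: "cat_functor D C G"
  proof
    show "on_Ob G Z \<in> Ob C" if "Z \<in> Ob D" for Z
      using that by (simp add: G_def G0)
    show "on_Hom G Z W g \<in> Hom C (on_Ob G Z) (on_Ob G W)"
      if "Z \<in> Ob D" "W \<in> Ob D" "g \<in> Hom D Z W" for Z W g
      using that by (simp add: G_def G0 pre_Hom conj_Hom)
    show "on_Hom G Z Z (Idt D Z) = Idt C (on_Ob G Z)" if Z: "Z \<in> Ob D" for Z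
      by (rule eqI[of "G0 Z" "G0 Z"])
        (use Z in \<open>simp_all add: G_def G0 pre_Hom conj_Hom FG C D F.on_Idt, simp add: conj_def
            F.target.Cmp_Idt_left FG0 eH de\<close>)
    show "on_Hom G Z V (Cmp D Z W V h g) =
        Cmp C (on_Ob G Z) (on_Ob G W) (on_Ob G V) (on_Hom G W V h) (on_Hom G Z W g)"
      if Z: "Z \<in> Ob D" and W: "W \<in> Ob D" and V: "V \<in> Ob D"
        and g: "g \<in> Hom D Z W" and h: "h \<in> Hom D W V" for Z W V g h
    proof -
      \<comment> \<open>In the middle of the right-hand side \<open>d W\<close> is followed by
        \<open>e W\<close>, which is the identity of \<open>W\<close>.\<close>
      have "conj Z V (Cmp D Z W V h g) =
          Cmp D (?F (G0 Z)) (?F (G0 W)) (?F (G0 V)) (conj W V h) (conj Z W g)"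
        using Z W V g h unfolding conj_def
        by (simp add: F.target.Cmp_assoc FG0 d eH D cancel_de)
      then show ?thesis
        using Z W V g h
        by (intro eqI[of "G0 Z" "G0 V"])
          (simp_all add: G_def G0 FG0 pre_Hom F_pre conj_Hom C D F.on_Cmp)
    qed
  qed
  have iso_d: "cat_iso D Z (?F (G0 Z)) (d Z)" if "Z \<in> Ob D" for Z
    unfolding cat_iso_def using d[OF that] eH[OF that] de[OF that] ed[OF that] by blast
  have "natural_iso C C id_map (comp_map G F) \<eta>"
    unfolding natural_iso_def
  proof (intro conjI ballI)
    fix X assume X: "X \<in> Ob C"
    show "cat_iso C (on_Ob id_map X) (on_Ob (comp_map G F) X) (\<eta> X)"
      using F.source.fully_faithful_reflects_iso[OF F bij X G0[OF F.on_Ob[OF X]] \<eta>_Hom[OF X]]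
        iso_d[OF F.on_Ob[OF X]] F\<eta>[OF X]
      by (simp add: id_map_def comp_map_def G_def)
  next
    fix X Y f assume X: "X \<in> Ob C" and Y: "Y \<in> Ob C" and f: "f \<in> Hom C X Y"
    have FX: "?F X \<in> Ob D" and FY: "?F Y \<in> Ob D" and Ff: "on_Hom F X Y f \<in> Hom D (?F X) (?F Y)"
      using X Y f by (auto intro: F.on_Ob F.on_Hom)
    have conj_d: "Cmp D (?F X) (?F (G0 (?F X))) (?F (G0 (?F Y))) (conj (?F X) (?F Y) (on_Hom F X Y f)) (d (?F X))
      = Cmp D (?F X) (?F Y) (?F (G0 (?F Y))) (d (?F Y)) (on_Hom F X Y f)"
      unfolding conj_def using FX FY Ff
      by (simp add: F.target.Cmp_assoc FG0 d eH D ed F.target.Cmp_Idt_right)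
    have "Cmp C X Y (G0 (?F Y)) (\<eta> Y) f =
        Cmp C X (G0 (?F X)) (G0 (?F Y)) (pre (G0 (?F X)) (G0 (?F Y)) (conj (?F X) (?F Y) (on_Hom F X Y f))) (\<eta> X)"
      by (rule eqI[of X "G0 (?F Y)"])
        (use X Y f FX FY Ff in \<open>simp_all add: C G0 \<eta>_Hom pre_Hom conj_Hom F.on_Cmp F\<eta> FG conj_d\<close>)
    then show "Cmp C (on_Ob id_map X) (on_Ob id_map Y) (on_Ob (comp_map G F) Y) (\<eta> Y) (on_Hom id_map X Y f) =
        Cmp C (on_Ob id_map X) (on_Ob (comp_map G F) X) (on_Ob (comp_map G F) Y)
          (on_Hom (comp_map G F) X Y f) (\<eta> X)"
      by (simp add: id_map_def comp_map_def G_def)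
  qed
  moreover have "natural_iso D D (comp_map F G) id_map e"
    unfolding natural_iso_def
  proof (intro conjI ballI)
    fix Z assume "Z \<in> Ob D"
    then show "cat_iso D (on_Ob (comp_map F G) Z) (on_Ob id_map Z) (e Z)"
      using e by (simp add: id_map_def comp_map_def G_def)
  next
    fix Z W g assume Z: "Z \<in> Ob D" and W: "W \<in> Ob D" and g: "g \<in> Hom D Z W"
    then have "Cmp D (?F (G0 Z)) (?F (G0 W)) W (e W) (conj Z W g) = Cmp D (?F (G0 Z)) Z W g (e Z)"
      by (simp add: conj_def cancel_de FG0 D eH)
    then show "Cmp D (on_Ob (comp_map F G) Z) (on_Ob (comp_map F G) W) (on_Ob id_map W) (e W)
          (on_Hom (comp_map F G) Z W g) =
        Cmp D (on_Ob (comp_map F G) Z) (on_Ob id_map Z) (on_Ob id_map W) (on_Hom id_map Z W g) (e Z)"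
      using Z W g by (simp add: id_map_def comp_map_def G_def FG)
  qed
  ultimately show ?thesis
    unfolding equivalent_categories_def using F G by blast
qed

section \<open>Prime filters of Heyting algebras\<close>

context heyting_algebra
begin

lemma meet_mono:
  assumes "a \<sqsubseteq> a'" "b \<sqsubseteq> b'" "a \<in> carrier H" "a' \<in> carrier H" "b \<in> carrier H" "b' \<in> carrier H"
  shows "a \<sqinter> b \<sqsubseteq> a' \<sqinter> b'"
  using assms by (meson le_trans meet_closed meet_le meet_left meet_right)

text \<open>Meeting with \<open>c\<close> is left adjoint to implication: \<open>a\<close> and
  \<open>b\<close> both lie below \<open>imp H c d\<close>, hence so does their join. This is the
  half of distributivity that can fail in a lattice.\<close>

lemma meet_join_le:
  assumes "a \<in> carrier H" "b \<in> carrier H" "c \<in> carrier H" "d \<in> carrier H"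
    and "c \<sqinter> a \<sqsubseteq> d" "c \<sqinter> b \<sqsubseteq> d"
  shows "c \<sqinter> (a \<squnion> b) \<sqsubseteq> d"
proof -
  have "a \<sqsubseteq> imp H c d" "b \<sqsubseteq> imp H c d"
    using assms by (simp_all add: imp_residual[symmetric] meet_comm)
  then have "(a \<squnion> b) \<sqinter> c \<sqsubseteq> d"
    using assms by (simp add: imp_residual imp_closed join_le)
  then show ?thesis
    by (simp add: meet_comm)
qed

lemma imp_meet_le:
  assumes "a \<in> carrier H" "b \<in> carrier H"
  shows "imp H a b \<sqinter> a \<sqsubseteq> b"
  using assms by (simp add: imp_residual imp_closed)

end

text \<open>Properness is left to \<open>prime_filters\<close>; disjointness from an ideal, which
  contains \<open>\<bottom>\<close>, supplies it.\<close>

definition lattice_filter :: "('a, 'e) gorder_scheme \<Rightarrow> 'a set \<Rightarrow> bool" where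
  "lattice_filter L F \<longleftrightarrow> F \<subseteq> carrier L \<and> \<top>\<^bsub>L\<^esub> \<in> F \<and>
     (\<forall>a \<in> F. \<forall>b \<in> carrier L. a \<sqsubseteq>\<^bsub>L\<^esub> b \<longrightarrow> b \<in> F) \<and> (\<forall>a \<in> F. \<forall>b \<in> F. a \<sqinter>\<^bsub>L\<^esub> b \<in> F)"

lemma lattice_filterI:
  assumes "F \<subseteq> carrier L" "\<top>\<^bsub>L\<^esub> \<in> F"
    and "\<And>a b. \<lbrakk>a \<in> F; b \<in> carrier L; a \<sqsubseteq>\<^bsub>L\<^esub> b\<rbrakk> \<Longrightarrow> b \<in> F"
    and "\<And>a b. \<lbrakk>a \<in> F; b \<in> F\<rbrakk> \<Longrightarrow> a \<sqinter>\<^bsub>L\<^esub> b \<in> F"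
  shows "lattice_filter L F"
  using assms unfolding lattice_filter_def by blast

lemma lattice_filterD:
  assumes "lattice_filter L F"
  shows "a \<in> F \<Longrightarrow> a \<in> carrier L" and "\<top>\<^bsub>L\<^esub> \<in> F"
    and "\<lbrakk>a \<in> F; a \<sqsubseteq>\<^bsub>L\<^esub> b; b \<in> carrier L\<rbrakk> \<Longrightarrow> b \<in> F"
    and "\<lbrakk>a \<in> F; b \<in> F\<rbrakk> \<Longrightarrow> a \<sqinter>\<^bsub>L\<^esub> b \<in> F"
  using assms unfolding lattice_filter_def by blast+

definition lattice_ideal :: "('a, 'e) gorder_scheme \<Rightarrow> 'a set \<Rightarrow> bool" where
  "lattice_ideal L I \<longleftrightarrow> I \<subseteq> carrier L \<and> \<bottom>\<^bsub>L\<^esub> \<in> I \<and>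
     (\<forall>a \<in> I. \<forall>b \<in> carrier L. b \<sqsubseteq>\<^bsub>L\<^esub> a \<longrightarrow> b \<in> I) \<and> (\<forall>a \<in> I. \<forall>b \<in> I. a \<squnion>\<^bsub>L\<^esub> b \<in> I)"

definition prime_filters :: "('a, 'e) gorder_scheme \<Rightarrow> 'a set set" where
  "prime_filters L = {F. lattice_filter L F \<and> \<bottom>\<^bsub>L\<^esub> \<notin> F \<and>
     (\<forall>a \<in> carrier L. \<forall>b \<in> carrier L. a \<squnion>\<^bsub>L\<^esub> b \<in> F \<longrightarrow> a \<in> F \<or> b \<in> F)}"

context heyting_algebra
begin

text \<open>The set is the filter generated by \<open>F\<close> and \<open>a\<close>. It serves the
  maximality argument for prime filters and the search for points that refute an
  implication.\<close>

lemma lattice_filter_extend: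
  assumes F: "lattice_filter H F" and a: "a \<in> carrier H"
  shows "lattice_filter H {c \<in> carrier H. \<exists>m \<in> F. m \<sqinter> a \<sqsubseteq> c}" (is "lattice_filter H ?G")
    and "F \<subseteq> {c \<in> carrier H. \<exists>m \<in> F. m \<sqinter> a \<sqsubseteq> c}" and "a \<in> {c \<in> carrier H. \<exists>m \<in> F. m \<sqinter> a \<sqsubseteq> c}"
proof -
  have FH: "\<And>m. m \<in> F \<Longrightarrow> m \<in> carrier H" and top: "\<top> \<in> F"
    and Fm: "\<And>m n. \<lbrakk>m \<in> F; n \<in> F\<rbrakk> \<Longrightarrow> m \<sqinter> n \<in> F"
    using F by (auto simp: lattice_filter_def)
  have "c \<sqinter> d \<in> ?G" if cd: "c \<in> ?G" "d \<in> ?G" for c d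
  proof -
    obtain m n where "m \<in> F" "m \<sqinter> a \<sqsubseteq> c" "n \<in> F" "n \<sqinter> a \<sqsubseteq> d" "c \<in> carrier H" "d \<in> carrier H"
      using cd by blast
    moreover from this have "(m \<sqinter> n) \<sqinter> a \<sqsubseteq> m \<sqinter> a" "(m \<sqinter> n) \<sqinter> a \<sqsubseteq> n \<sqinter> a"
      using a FH by (auto intro!: meet_mono meet_left meet_right)
    ultimately have "(m \<sqinter> n) \<sqinter> a \<sqsubseteq> c \<sqinter> d"
      using a FH by (meson meet_le le_trans meet_closed)
    then show ?thesis
      using Fm \<open>m \<in> F\<close> \<open>n \<in> F\<close> \<open>c \<in> carrier H\<close> \<open>d \<in> carrier H\<close> by auto
  qed
  moreover have "\<top> \<in> ?G"
    using top a by (auto intro!: bexI[of _ \<top>] top_higher)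
  moreover have "d \<in> ?G" if cd: "c \<in> ?G" "d \<in> carrier H" "c \<sqsubseteq> d" for c d
  proof -
    obtain m where m: "m \<in> F" "m \<sqinter> a \<sqsubseteq> c" "c \<in> carrier H"
      using cd by blast
    then have "m \<sqinter> a \<sqsubseteq> d"
      using cd a FH by (meson le_trans meet_closed)
    then show ?thesis
      using cd m by blast
  qed
  ultimately show "lattice_filter H ?G"
    by (intro lattice_filterI) blast+
  show "F \<subseteq> ?G"
    using a FH meet_left by blast
  show "a \<in> ?G"
    using a FH top meet_right by blast
qed

lemma lattice_ideal_principal:
  assumes "b \<in> carrier H"
  shows "lattice_ideal H {c \<in> carrier H. c \<sqsubseteq> b}"
  using assms by (auto simp: lattice_ideal_def join_le bottom_lower intro: le_trans)

text \<open>Zorn's lemma yields a filter \<open>M\<close> maximal among those containing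
  \<open>F\<close> and avoiding \<open>I\<close>. Primeness comes from distributivity: if
  \<open>a\<close> and \<open>b\<close> lie outside \<open>M\<close>, some
  \<open>m \<sqinter> n\<close> in \<open>M\<close> has its meets with \<open>a\<close> and with
  \<open>b\<close> below one element of \<open>I\<close>, hence also its meet with
  \<open>a \<squnion> b\<close>.\<close>

theorem prime_filter_exists:
  assumes F: "lattice_filter H F" and I: "lattice_ideal H I" and FI: "F \<inter> I = {}"
  obtains P where "P \<in> prime_filters H" "F \<subseteq> P" "P \<inter> I = {}"
proof -
  define \<F> where "\<F> = {G. lattice_filter H G \<and> F \<subseteq> G \<and> G \<inter> I = {}}"
  have "\<exists>M \<in> \<F>. \<forall>G \<in> \<F>. M \<subseteq> G \<longrightarrow> G = M"
  proof (rule subset_Zorn_nonempty)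
    show "\<F> \<noteq> {}"
      using F FI by (auto simp: \<F>_def)
    fix \<C> assume ne: "\<C> \<noteq> {}" and chain: "subset.chain \<F> \<C>"
    have \<C>: "\<C> \<subseteq> \<F>" and lin: "\<And>G K. \<lbrakk>G \<in> \<C>; K \<in> \<C>\<rbrakk> \<Longrightarrow> G \<subseteq> K \<or> K \<subseteq> G"
      using chain by (auto simp: subset_chain_def)
    have \<C>f: "\<And>G. G \<in> \<C> \<Longrightarrow> lattice_filter H G"
      using \<C> by (auto simp: \<F>_def)
    have "lattice_filter H (\<Union>\<C>)"
    proof (rule lattice_filterI)
      show "\<Union>\<C> \<subseteq> carrier H"
        using lattice_filterD(1)[OF \<C>f] by blast
      show "\<top> \<in> \<Union>\<C>"
        using lattice_filterD(2)[OF \<C>f] ne by blast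
      show "b \<in> \<Union>\<C>" if "a \<in> \<Union>\<C>" "b \<in> carrier H" "a \<sqsubseteq> b" for a b
        using lattice_filterD(3)[OF \<C>f] that by blast
      show "a \<sqinter> b \<in> \<Union>\<C>" if ab: "a \<in> \<Union>\<C>" "b \<in> \<Union>\<C>" for a b
      proof -
        obtain G K where GK: "a \<in> G" "G \<in> \<C>" "b \<in> K" "K \<in> \<C>"
          using ab by blast
        then obtain L where "L \<in> \<C>" "a \<in> L" "b \<in> L"
          using lin[of G K] by blast
        then show ?thesis
          using lattice_filterD(4)[OF \<C>f] by blast
      qed
    qed
    then show "\<Union>\<C> \<in> \<F>"
      using \<C> ne by (auto simp: \<F>_def)
  qed
  then obtain M where M: "M \<in> \<F>" and max: "\<And>G. \<lbrakk>G \<in> \<F>; M \<subseteq> G\<rbrakk> \<Longrightarrow> G = M"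
    by blast
  have Mf: "lattice_filter H M" and FM: "F \<subseteq> M" and MI: "M \<inter> I = {}"
    using M by (auto simp: \<F>_def)
  have MH: "\<And>m. m \<in> M \<Longrightarrow> m \<in> carrier H" and Mm: "\<And>m n. \<lbrakk>m \<in> M; n \<in> M\<rbrakk> \<Longrightarrow> m \<sqinter> n \<in> M"
    using Mf by (auto simp: lattice_filter_def)
  have Id: "\<And>a b. \<lbrakk>a \<in> I; b \<in> carrier H; b \<sqsubseteq> a\<rbrakk> \<Longrightarrow> b \<in> I" and Ij: "\<And>a b. \<lbrakk>a \<in> I; b \<in> I\<rbrakk> \<Longrightarrow> a \<squnion> b \<in> I"
    and IH: "\<And>a. a \<in> I \<Longrightarrow> a \<in> carrier H"
    using I by (auto simp: lattice_ideal_def)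
  \<comment> \<open>By maximality, adjoining \<open>a\<close> to \<open>M\<close> gives a filter
    that meets \<open>I\<close>.\<close>
  have meets_ideal: "\<exists>m \<in> M. \<exists>c \<in> I. m \<sqinter> a \<sqsubseteq> c" if a: "a \<in> carrier H" "a \<notin> M" for a
  proof (rule ccontr)
    assume no: "\<not> ?thesis"
    let ?G = "{c \<in> carrier H. \<exists>m \<in> M. m \<sqinter> a \<sqsubseteq> c}"
    note ext = lattice_filter_extend[OF Mf a(1)]
    have "?G \<in> \<F>"
      using ext FM no by (auto simp: \<F>_def)
    then show False
      using max[of ?G] ext a(2) by blast
  qed
  have "a \<in> M \<or> b \<in> M" if ab: "a \<in> carrier H" "b \<in> carrier H" "a \<squnion> b \<in> M" for a b
  proof (rule ccontr)
    assume "\<not> ?thesis"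
    then obtain m c n d where m: "m \<in> M" "c \<in> I" "m \<sqinter> a \<sqsubseteq> c" and n: "n \<in> M" "d \<in> I" "n \<sqinter> b \<sqsubseteq> d"
      using meets_ideal ab by metis
    have H: "m \<in> carrier H" "n \<in> carrier H" "c \<in> carrier H" "d \<in> carrier H"
      using m n MH IH by auto
    have mn: "m \<sqinter> n \<sqsubseteq> m" "m \<sqinter> n \<sqsubseteq> n"
      using H by (auto intro: meet_left meet_right)
    have "(m \<sqinter> n) \<sqinter> a \<sqsubseteq> m \<sqinter> a" "(m \<sqinter> n) \<sqinter> b \<sqsubseteq> n \<sqinter> b"
      using H ab mn by (auto intro!: meet_mono)
    then have "(m \<sqinter> n) \<sqinter> a \<sqsubseteq> c \<squnion> d" "(m \<sqinter> n) \<sqinter> b \<sqsubseteq> c \<squnion> d"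
      using m(3) n(3) H ab by (meson join_closed join_left join_right le_trans meet_closed)+
    then have "(m \<sqinter> n) \<sqinter> (a \<squnion> b) \<sqsubseteq> c \<squnion> d"
      using H ab by (intro meet_join_le) auto
    then have "(m \<sqinter> n) \<sqinter> (a \<squnion> b) \<in> I"
      using H ab by (intro Id[OF Ij[OF m(2) n(2)]]) auto
    moreover have "(m \<sqinter> n) \<sqinter> (a \<squnion> b) \<in> M"
      using Mm m n ab by blast
    ultimately show False
      using MI by blast
  qed
  moreover have "\<bottom> \<notin> M"
    using MI I by (auto simp: lattice_ideal_def)
  ultimately have "M \<in> prime_filters H"
    using Mf by (auto simp: prime_filters_def)
  then show ?thesis
    using that FM MI by blast
qed

end

section \<open>Clopen up-sets of Esakia spaces\<close>

text \<open>Directedness replaces a finite subcover by one upper bound. The families used below are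
  indexed by clopen sets, so that a single covering member is directly an inclusion between
  them.\<close>

lemma compact_space_directed_cover:
  assumes T: "compact_space T" and K: "closedin T K"
    and op: "\<And>U. U \<in> \<U> \<Longrightarrow> openin T U" and ne: "\<U> \<noteq> {}"
    and dir: "\<And>U V. \<lbrakk>U \<in> \<U>; V \<in> \<U>\<rbrakk> \<Longrightarrow> \<exists>W \<in> \<U>. U \<union> V \<subseteq> W"
    and cov: "K \<subseteq> \<Union>\<U>"
  shows "\<exists>U \<in> \<U>. K \<subseteq> U"
proof -
  have "compactin T K"
    by (rule closedin_compact_space[OF T K])
  then obtain \<F> where \<F>: "finite \<F>" "\<F> \<subseteq> \<U>" "K \<subseteq> \<Union>\<F>"
    using compactinD[OF _ op cov] by blast
  from \<F>(1,2) obtain U where "U \<in> \<U>" "\<Union>\<F> \<subseteq> U"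
  proof (induction \<F> arbitrary: thesis)
    \<comment> \<open>A finite subcover may be empty; nonemptiness of \<open>\<U>\<close> then
      supplies the bound.\<close>
    case empty
    then show ?case using ne by auto
  next
    case (insert V \<F>)
    obtain U where U: "U \<in> \<U>" "\<Union>\<F> \<subseteq> U"
      using insert.IH insert.prems by auto
    then obtain W where W: "W \<in> \<U>" "V \<union> U \<subseteq> W"
      using dir[of V U] insert.prems by auto
    then have "\<Union>(insert V \<F>) \<subseteq> W"
      using U(2) by auto
    then show ?case
      using insert.prems(1)[OF W(1)] by simp
  qed
  with \<F>(3) show ?thesis
    by (intro bexI[of _ U]) (rule subset_trans)
qed

text \<open>Separation stays outside the locale because it is used in two strengths:
  \<open>neighbourhood\<close> and \<open>clopen_mem\<close> need a member that contains
  \<open>x\<close> and omits \<open>y\<close>, \<open>basis\<close> a member containing exactly one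
  of them. The instances are the clopen up-sets of an Esakia space and the basic sets of a
  spectrum.\<close>

locale clopen_lattice =
  fixes T :: "'p topology" and \<L> :: "'p set set"
  assumes compact: "compact_space T"
    and clopen: "U \<in> \<L> \<Longrightarrow> openin T U" "U \<in> \<L> \<Longrightarrow> closedin T U"
    and empty: "{} \<in> \<L>" and whole: "topspace T \<in> \<L>"
    and Un: "\<lbrakk>U \<in> \<L>; V \<in> \<L>\<rbrakk> \<Longrightarrow> U \<union> V \<in> \<L>"
    and Int: "\<lbrakk>U \<in> \<L>; V \<in> \<L>\<rbrakk> \<Longrightarrow> U \<inter> V \<in> \<L>"
begin

text \<open>The complements of the members around \<open>x\<close>, each enlarged by
  \<open>W\<close>, cover the space, and they are directed because \<open>\<L>\<close> is closed
  under intersection. That one of them covers says that its \<open>U\<close> lies in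
  \<open>W\<close>.\<close>

lemma neighbourhood:
  assumes W: "openin T W" and x: "x \<in> W"
    and sep: "\<And>y. y \<in> topspace T - W \<Longrightarrow> \<exists>U \<in> \<L>. x \<in> U \<and> y \<notin> U"
  shows "\<exists>U \<in> \<L>. x \<in> U \<and> U \<subseteq> W"
proof -
  let ?\<U> = "(\<lambda>U. W \<union> (topspace T - U)) ` {U \<in> \<L>. x \<in> U}"
  have xT: "x \<in> topspace T"
    using W x openin_subset by blast
  have "\<exists>D \<in> ?\<U>. topspace T \<subseteq> D"
  proof (rule compact_space_directed_cover[OF compact closedin_topspace])
    show "openin T D" if "D \<in> ?\<U>" for D
      using that W clopen(2) by auto
    show "?\<U> \<noteq> {}"
      using whole xT by auto
    show "\<exists>F \<in> ?\<U>. D \<union> E \<subseteq> F" if DE: "D \<in> ?\<U>" "E \<in> ?\<U>" for D E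
    proof -
      obtain U V where "U \<in> \<L>" "x \<in> U" "V \<in> \<L>" "x \<in> V"
        "D = W \<union> (topspace T - U)" "E = W \<union> (topspace T - V)"
        using DE by auto
      then show ?thesis
        using Int by (intro bexI[of _ "W \<union> (topspace T - U \<inter> V)"]) auto
    qed
    show "topspace T \<subseteq> \<Union>?\<U>"
    proof
      fix y assume y: "y \<in> topspace T"
      obtain U where "U \<in> \<L>" "x \<in> U" "y \<in> W \<union> (topspace T - U)"
      proof (cases "y \<in> W")
        case True
        then show ?thesis
          using that[OF whole xT] by simp
      next
        case False
        then show ?thesis
          using sep[of y] y that by blast
      qed
      then show "y \<in> \<Union>?\<U>"
        by blast
    qed
  qed
  then obtain U where U: "U \<in> \<L>" "x \<in> U" "topspace T \<subseteq> W \<union> (topspace T - U)"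
    by auto
  then have "U \<subseteq> W"
    using openin_subset[OF clopen(1)[OF U(1)]] by blast
  then show ?thesis
    using U by blast
qed

text \<open>The members contained in \<open>W\<close> are directed under union and cover the compact
  set \<open>W\<close>, so one of them equals \<open>W\<close>.\<close>

lemma clopen_mem:
  assumes W: "openin T W" "closedin T W"
    and sep: "\<And>x y. \<lbrakk>x \<in> W; y \<in> topspace T - W\<rbrakk> \<Longrightarrow> \<exists>U \<in> \<L>. x \<in> U \<and> y \<notin> U"
  shows "W \<in> \<L>"
proof -
  let ?\<U> = "{U \<in> \<L>. U \<subseteq> W}"
  have "\<exists>U \<in> ?\<U>. W \<subseteq> U"
  proof (rule compact_space_directed_cover[OF compact W(2)])
    show "openin T U" if "U \<in> ?\<U>" for U
      using that clopen(1) by auto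
    show "?\<U> \<noteq> {}"
      using empty by blast
    show "\<exists>F \<in> ?\<U>. U \<union> V \<subseteq> F" if "U \<in> ?\<U>" "V \<in> ?\<U>" for U V
      using that Un by blast
    show "W \<subseteq> \<Union>?\<U>"
      using neighbourhood[OF W(1)] sep by blast
  qed
  then obtain U where "U \<in> \<L>" "U = W"
    by blast
  then show ?thesis
    by simp
qed

text \<open>A separating set may contain either point, so differences are needed. The set
  \<open>W \<union> V \<union> (topspace T - U)\<close> covers the space exactly when
  \<open>U - V \<subseteq> W\<close>.\<close>

lemma basis:
  assumes W: "openin T W" and x: "x \<in> W"
    and sep: "\<And>y. y \<in> topspace T - W \<Longrightarrow> \<exists>U \<in> \<L>. (x \<in> U) \<noteq> (y \<in> U)"
  shows "\<exists>U \<in> \<L>. \<exists>V \<in> \<L>. x \<in> U - V \<and> U - V \<subseteq> W"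
proof -
  define \<U> where "\<U> = {W \<union> V \<union> (topspace T - U) | U V. U \<in> \<L> \<and> V \<in> \<L> \<and> x \<in> U \<and> x \<notin> V}"
  have mem: "W \<union> V \<union> (topspace T - U) \<in> \<U>" if "U \<in> \<L>" "V \<in> \<L>" "x \<in> U" "x \<notin> V" for U V
    unfolding \<U>_def using that by blast
  have xT: "x \<in> topspace T"
    using W x openin_subset by blast
  have "\<exists>D \<in> \<U>. topspace T \<subseteq> D"
  proof (rule compact_space_directed_cover[OF compact closedin_topspace])
    show "openin T D" if "D \<in> \<U>" for D
      using that W clopen by (auto simp: \<U>_def)
    show "\<U> \<noteq> {}"
      using mem[OF whole empty xT] by auto
    show "\<exists>F \<in> \<U>. D \<union> E \<subseteq> F" if DE: "D \<in> \<U>" "E \<in> \<U>" for D E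
    proof -
      obtain U V where UV: "U \<in> \<L>" "V \<in> \<L>" "x \<in> U" "x \<notin> V" "D = W \<union> V \<union> (topspace T - U)"
        using DE(1) unfolding \<U>_def by blast
      obtain U' V' where UV': "U' \<in> \<L>" "V' \<in> \<L>" "x \<in> U'" "x \<notin> V'" "E = W \<union> V' \<union> (topspace T - U')"
        using DE(2) unfolding \<U>_def by blast
      have "W \<union> (V \<union> V') \<union> (topspace T - U \<inter> U') \<in> \<U>"
        using UV UV' by (intro mem Int Un) auto
      then show ?thesis
        using UV(5) UV'(5) by (auto intro: rev_bexI)
    qed
    show "topspace T \<subseteq> \<Union>\<U>"
    proof
      fix y assume y: "y \<in> topspace T"
      obtain U V where UV: "U \<in> \<L>" "V \<in> \<L>" "x \<in> U" "x \<notin> V" "y \<in> W \<union> V \<union> (topspace T - U)"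
      proof (cases "y \<in> W")
        case True
        then show ?thesis
          using that[OF whole empty xT] by simp
      next
        case False
        then obtain U where "U \<in> \<L>" "(x \<in> U) \<noteq> (y \<in> U)"
          using sep y by blast
        then show ?thesis
          \<comment> \<open>A separating set around \<open>x\<close> serves as \<open>U\<close> with
            empty \<open>V\<close>; one around \<open>y\<close> serves as \<open>V\<close> with the
            whole space as \<open>U\<close>.\<close>
          using that[OF whole, of U] that[OF _ empty, of U] xT y by (cases "x \<in> U") auto
      qed
      show "y \<in> \<Union>\<U>"
        using UnionI[OF mem[OF UV(1-4)] UV(5)] .
    qed
  qed
  then obtain U V where UV: "U \<in> \<L>" "V \<in> \<L>" "x \<in> U - V" "topspace T \<subseteq> W \<union> V \<union> (topspace T - U)"
    unfolding \<U>_def by blast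
  then have "U - V \<subseteq> W"
    using openin_subset[OF clopen(1)[OF UV(1)]] by auto
  then show ?thesis
    using UV by blast
qed

end

section \<open>Clopen up-sets and their Heyting implication\<close>

lemma clopen_upsets_iff:
  "U \<in> clopen_upsets X \<longleftrightarrow> openin (tau X) U \<and> closedin (tau X) U \<and>
     (\<forall>x y. x \<in> U \<longrightarrow> y \<in> points X \<longrightarrow> (x, y) \<in> ord X \<longrightarrow> y \<in> U)"
  by (auto simp: clopen_upsets_def clopens_def up_def)

lemma clopen_upset_open: "U \<in> clopen_upsets X \<Longrightarrow> openin (tau X) U"
  and clopen_upset_closed: "U \<in> clopen_upsets X \<Longrightarrow> closedin (tau X) U"
  by (simp_all add: clopen_upsets_def clopens_def)

lemma clopen_upset_subset: "U \<in> clopen_upsets X \<Longrightarrow> x \<in> U \<Longrightarrow> x \<in> points X"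
  by (meson clopen_upsets_iff openin_subset subsetD)

text \<open>The relative pseudocomplement in the lattice of clopen up-sets: the largest
  \<open>W\<close> with \<open>W \<inter> U \<subseteq> V\<close>.\<close>

abbreviation clopen_imp :: "('p, 'e) modal_esakia_scheme \<Rightarrow> 'p set \<Rightarrow> 'p set \<Rightarrow> 'p set" where
  "clopen_imp X U V \<equiv> points X - down X (U - V)"

context esakia_space
begin

lemma ord_refl: "x \<in> points X \<Longrightarrow> (x, x) \<in> ord X"
  and ord_trans: "\<lbrakk>(x, y) \<in> ord X; (y, z) \<in> ord X\<rbrakk> \<Longrightarrow> (x, z) \<in> ord X"
  and ord_antisym: "\<lbrakk>(x, y) \<in> ord X; (y, x) \<in> ord X\<rbrakk> \<Longrightarrow> x = y"
  and ord_points: "(x, y) \<in> ord X \<Longrightarrow> x \<in> points X" "(x, y) \<in> ord X \<Longrightarrow> y \<in> points X"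
  using partial_order_onD[OF order] by (auto dest: refl_onD transD antisymD)

lemma upsetD: "\<lbrakk>U \<in> clopen_upsets X; (x, y) \<in> ord X; x \<in> U\<rbrakk> \<Longrightarrow> y \<in> U"
  using ord_points by (auto simp: clopen_upsets_iff)

sublocale clopen_upsets: clopen_lattice "tau X" "clopen_upsets X"
proof
  show "compact_space (tau X)"
    by (rule compact)
  show "U \<union> V \<in> clopen_upsets X" if "U \<in> clopen_upsets X" "V \<in> clopen_upsets X" for U V
    using that unfolding clopen_upsets_iff by blast
  show "U \<inter> V \<in> clopen_upsets X" if "U \<in> clopen_upsets X" "V \<in> clopen_upsets X" for U V
    using that unfolding clopen_upsets_iff by blast
  show "{} \<in> clopen_upsets X" "points X \<in> clopen_upsets X"
    by (simp_all add: clopen_upsets_iff)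
  show "openin (tau X) U" "closedin (tau X) U" if "U \<in> clopen_upsets X" for U
    using that by (rule clopen_upset_open, rule clopen_upset_closed)
qed

lemma ord_iff:
  assumes "x \<in> points X" "y \<in> points X"
  shows "(x, y) \<in> ord X \<longleftrightarrow> (\<forall>U \<in> clopen_upsets X. x \<in> U \<longrightarrow> y \<in> U)"
  using upsetD separation[OF assms] by (cases "(x, y) \<in> ord X") auto

lemma point_eqI:
  assumes "x \<in> points X" "y \<in> points X" and "\<And>U. U \<in> clopen_upsets X \<Longrightarrow> x \<in> U \<longleftrightarrow> y \<in> U"
  shows "x = y"
  by (rule ord_antisym) (simp_all add: ord_iff assms)

lemma clopen_imp_mem_iff:
  assumes "x \<in> points X"
  shows "x \<in> clopen_imp X U V \<longleftrightarrow> (\<forall>y. (x, y) \<in> ord X \<longrightarrow> y \<in> U \<longrightarrow> y \<in> V)"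
  using assms by (auto simp: down_def)

text \<open>The Esakia condition is applied to \<open>U - V\<close>, which is clopen but in general
  not an up-set; transitivity makes the complement of its down-set an up-set.\<close>

lemma clopen_imp_closed:
  assumes U: "U \<in> clopen_upsets X" and V: "V \<in> clopen_upsets X"
  shows "clopen_imp X U V \<in> clopen_upsets X"
proof -
  have "U - V \<in> clopens X"
    using assms by (auto simp: clopens_def intro: openin_diff closedin_diff clopen_upset_open clopen_upset_closed)
  then have "down X (U - V) \<in> clopens X"
    by (rule down_clopen)
  moreover have "y \<in> clopen_imp X U V" if "x \<in> clopen_imp X U V" "(x, y) \<in> ord X" for x y
  proof -
    have "x \<in> points X" "y \<in> points X"
      using that(2) by (simp_all add: ord_points)
    with that show ?thesis
      unfolding clopen_imp_mem_iff[OF \<open>x \<in> points X\<close>] clopen_imp_mem_iff[OF \<open>y \<in> points X\<close>]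
      using ord_trans by blast
  qed
  ultimately show ?thesis
    unfolding clopen_upsets_iff clopens_def
    by (intro conjI openin_diff closedin_diff openin_topspace closedin_topspace) blast+
qed

lemma clopen_imp_residual:
  assumes "W \<in> clopen_upsets X"
  shows "W \<inter> U \<subseteq> V \<longleftrightarrow> W \<subseteq> clopen_imp X U V"
proof (intro iffI subsetI)
  fix x assume WUV: "W \<inter> U \<subseteq> V" and x: "x \<in> W"
  show "x \<in> clopen_imp X U V"
    unfolding clopen_imp_mem_iff[OF clopen_upset_subset[OF assms x]]
    using upsetD[OF assms _ x] WUV by blast
next
  fix x assume WUV: "W \<subseteq> clopen_imp X U V" and x: "x \<in> W \<inter> U"
  have xX: "x \<in> points X"
    using clopen_upset_subset[OF assms] x by blast
  have "x \<in> clopen_imp X U V"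
    using WUV x by blast
  then show "x \<in> V"
    unfolding clopen_imp_mem_iff[OF xX] using ord_refl[OF xX] x by blast
qed

end

section \<open>The point map dual to a Heyting homomorphism of clopen up-sets\<close>

locale clopen_upset_hom =
  source: esakia_space X + target: esakia_space Y
  for X :: "'p modal_esakia" and Y :: "'p modal_esakia" +
  fixes h :: "'p set \<Rightarrow> 'p set"
  assumes closed: "U \<in> clopen_upsets Y \<Longrightarrow> h U \<in> clopen_upsets X"
    and empty: "h {} = {}" and points: "h (points Y) = points X"
    and Int: "\<lbrakk>U \<in> clopen_upsets Y; V \<in> clopen_upsets Y\<rbrakk> \<Longrightarrow> h (U \<inter> V) = h U \<inter> h V"
    and Un: "\<lbrakk>U \<in> clopen_upsets Y; V \<in> clopen_upsets Y\<rbrakk> \<Longrightarrow> h (U \<union> V) = h U \<union> h V"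
    and imp: "\<lbrakk>U \<in> clopen_upsets Y; V \<in> clopen_upsets Y\<rbrakk>
      \<Longrightarrow> h (clopen_imp Y U V) = clopen_imp X (h U) (h V)"
begin

lemma mono: "\<lbrakk>U \<in> clopen_upsets Y; V \<in> clopen_upsets Y; U \<subseteq> V\<rbrakk> \<Longrightarrow> h U \<subseteq> h V"
  using Int[of U V] by (simp add: Int_absorb2 inf.absorb_iff1)

text \<open>The sets \<open>U\<close> with \<open>x \<in> h U\<close> form a prime filter, which
  compactness realizes by a point. Otherwise the sets \<open>V \<union> (points Y - U)\<close> with
  \<open>x \<in> h U\<close> and \<open>x \<notin> h V\<close> cover \<open>Y\<close>; then a single
  one does, so \<open>U \<subseteq> V\<close> and \<open>h U \<subseteq> h V\<close>, against the
  choice of \<open>U\<close> and \<open>V\<close>.\<close>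

lemma dual_point:
  assumes x: "x \<in> points X"
  shows "\<exists>y \<in> points Y. \<forall>U \<in> clopen_upsets Y. y \<in> U \<longleftrightarrow> x \<in> h U"
proof (rule ccontr)
  assume no: "\<not> ?thesis"
  define \<U> where "\<U> = {V \<union> (points Y - U) | U V.
    U \<in> clopen_upsets Y \<and> V \<in> clopen_upsets Y \<and> x \<in> h U \<and> x \<notin> h V}"
  have mem: "V \<union> (points Y - U) \<in> \<U>"
    if "U \<in> clopen_upsets Y" "V \<in> clopen_upsets Y" "x \<in> h U" "x \<notin> h V" for U V
    unfolding \<U>_def using that by blast
  note CU = target.clopen_upsets.clopen target.clopen_upsets.Un target.clopen_upsets.Int
  note whole = target.clopen_upsets.whole and void = target.clopen_upsets.empty
  have xh: "x \<in> h (points Y)" "x \<notin> h {}"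
    using x empty points by auto
  have "\<exists>D \<in> \<U>. points Y \<subseteq> D"
  proof (rule compact_space_directed_cover[OF target.compact closedin_topspace])
    show "openin (tau Y) D" if "D \<in> \<U>" for D
      using that CU by (auto simp: \<U>_def)
    show "\<U> \<noteq> {}"
      using mem[OF whole void xh] by auto
    show "\<exists>F \<in> \<U>. D \<union> E \<subseteq> F" if DE: "D \<in> \<U>" "E \<in> \<U>" for D E
    proof -
      obtain U V where UV: "U \<in> clopen_upsets Y" "V \<in> clopen_upsets Y" "x \<in> h U" "x \<notin> h V"
        "D = V \<union> (points Y - U)"
        using DE(1) unfolding \<U>_def by blast
      obtain U' V' where UV': "U' \<in> clopen_upsets Y" "V' \<in> clopen_upsets Y" "x \<in> h U'" "x \<notin> h V'"
        "E = V' \<union> (points Y - U')"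
        using DE(2) unfolding \<U>_def by blast
      have "(V \<union> V') \<union> (points Y - U \<inter> U') \<in> \<U>"
        using UV UV' by (intro mem CU) (auto simp: Int Un)
      then show ?thesis
        using UV(5) UV'(5) by (auto intro: rev_bexI)
    qed
    show "points Y \<subseteq> \<Union>\<U>"
    proof
      fix y assume y: "y \<in> points Y"
      obtain U where "U \<in> clopen_upsets Y" "(y \<in> U) \<noteq> (x \<in> h U)"
        using no y by blast
      then obtain U V where UV: "U \<in> clopen_upsets Y" "V \<in> clopen_upsets Y" "x \<in> h U" "x \<notin> h V"
        "y \<in> V \<union> (points Y - U)"
        using that[OF whole, of U] that[OF _ void, of U] xh y by (cases "x \<in> h U") auto
      show "y \<in> \<Union>\<U>"
        using UnionI[OF mem[OF UV(1-4)] UV(5)] .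
    qed
  qed
  then obtain U V where UV: "U \<in> clopen_upsets Y" "V \<in> clopen_upsets Y" "x \<in> h U" "x \<notin> h V"
    "points Y \<subseteq> V \<union> (points Y - U)"
    unfolding \<U>_def by blast
  then have "U \<subseteq> V"
    using clopen_upset_subset[OF UV(1)] by auto
  then show False
    using mono UV by blast
qed

text \<open>On \<open>points X\<close> the choice is forced, since clopen up-sets separate the
  points of \<open>Y\<close>.\<close>

definition dual :: "'p \<Rightarrow> 'p" where
  "dual = (\<lambda>x \<in> points X. SOME y. y \<in> points Y \<and> (\<forall>U \<in> clopen_upsets Y. y \<in> U \<longleftrightarrow> x \<in> h U))"

lemma
  assumes "x \<in> points X"
  shows dual_points: "dual x \<in> points Y"
    and dual_iff: "U \<in> clopen_upsets Y \<Longrightarrow> dual x \<in> U \<longleftrightarrow> x \<in> h U"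
proof -
  have "dual x \<in> points Y \<and> (\<forall>U \<in> clopen_upsets Y. dual x \<in> U \<longleftrightarrow> x \<in> h U)"
    unfolding dual_def restrict_apply'[OF assms]
    by (rule someI_ex) (use dual_point[OF assms] in blast)
  then show "dual x \<in> points Y" "U \<in> clopen_upsets Y \<Longrightarrow> dual x \<in> U \<longleftrightarrow> x \<in> h U"
    by blast+
qed

lemma dual_vimage: "U \<in> clopen_upsets Y \<Longrightarrow> dual -` U \<inter> points X = h U"
  using dual_iff clopen_upset_subset[OF closed] by blast

text \<open>Preservation of implication enters here. If no suitable \<open>z\<close> exists,
  compactness yields \<open>W \<inter> h U \<subseteq> h V\<close> with \<open>x \<in> W\<close>,
  \<open>y \<in> U\<close> and \<open>y \<notin> V\<close>. By residuation
  \<open>x \<in> h (clopen_imp Y U V)\<close>, so \<open>dual x\<close> lies in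
  \<open>clopen_imp Y U V\<close>, which \<open>y\<close> refutes.\<close>

lemma dual_lift:
  assumes x: "x \<in> points X" and y: "(dual x, y) \<in> ord Y"
  shows "\<exists>z. (x, z) \<in> ord X \<and> dual z = y"
proof (rule ccontr)
  assume no: "\<not> ?thesis"
  define \<U> where "\<U> = {(points X - W) \<union> h V \<union> (points X - h U) | W U V.
    W \<in> clopen_upsets X \<and> U \<in> clopen_upsets Y \<and> V \<in> clopen_upsets Y \<and> x \<in> W \<and> y \<in> U \<and> y \<notin> V}"
  have mem: "(points X - W) \<union> h V \<union> (points X - h U) \<in> \<U>"
    if "W \<in> clopen_upsets X" "U \<in> clopen_upsets Y" "V \<in> clopen_upsets Y" "x \<in> W" "y \<in> U" "y \<notin> V"
    for W U V
    unfolding \<U>_def using that by blast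
  have yY: "y \<in> points Y"
    using y target.ord_points by blast
  note whole = target.clopen_upsets.whole and void = target.clopen_upsets.empty
  note wholeX = source.clopen_upsets.whole
  have "\<exists>D \<in> \<U>. points X \<subseteq> D"
  proof (rule compact_space_directed_cover[OF source.compact closedin_topspace])
    show "openin (tau X) D" if D: "D \<in> \<U>" for D
    proof -
      obtain W U V where WUV: "W \<in> clopen_upsets X" "U \<in> clopen_upsets Y" "V \<in> clopen_upsets Y"
        "D = (points X - W) \<union> h V \<union> (points X - h U)"
        using D unfolding \<U>_def by blast
      then show ?thesis
        using closed[of U] closed[of V] source.clopen_upsets.clopen
        by (auto intro!: openin_Un openin_diff)
    qed
    show "\<U> \<noteq> {}"
      using mem[OF wholeX whole void x yY] by auto
    show "\<exists>F \<in> \<U>. D \<union> E \<subseteq> F" if DE: "D \<in> \<U>" "E \<in> \<U>" for D E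
    proof -
      obtain W U V where WUV: "W \<in> clopen_upsets X" "U \<in> clopen_upsets Y" "V \<in> clopen_upsets Y"
        "x \<in> W" "y \<in> U" "y \<notin> V" "D = (points X - W) \<union> h V \<union> (points X - h U)"
        using DE(1) unfolding \<U>_def by blast
      obtain W' U' V' where WUV': "W' \<in> clopen_upsets X" "U' \<in> clopen_upsets Y" "V' \<in> clopen_upsets Y"
        "x \<in> W'" "y \<in> U'" "y \<notin> V'" "E = (points X - W') \<union> h V' \<union> (points X - h U')"
        using DE(2) unfolding \<U>_def by blast
      have "(points X - W \<inter> W') \<union> h (V \<union> V') \<union> (points X - h (U \<inter> U')) \<in> \<U>"
        using WUV WUV'
        by (intro mem source.clopen_upsets.Int target.clopen_upsets.Int target.clopen_upsets.Un) auto
      moreover have "D \<union> E \<subseteq> (points X - W \<inter> W') \<union> h (V \<union> V') \<union> (points X - h (U \<inter> U'))"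
        unfolding WUV(7) WUV'(7) Un[OF WUV(3) WUV'(3)] Int[OF WUV(2) WUV'(2)] by blast
      ultimately show ?thesis
        by (rule rev_bexI)
    qed
    show "points X \<subseteq> \<Union>\<U>"
    proof
      fix z assume z: "z \<in> points X"
      obtain W U V where WUV: "W \<in> clopen_upsets X" "U \<in> clopen_upsets Y" "V \<in> clopen_upsets Y"
        "x \<in> W" "y \<in> U" "y \<notin> V" "z \<in> (points X - W) \<union> h V \<union> (points X - h U)"
      \<comment> \<open>A point above \<open>x\<close> has a dual point different from
        \<open>y\<close>, and a clopen up-set telling the two apart serves as \<open>U\<close> or
        \<open>V\<close>; any other point is excluded by some \<open>W\<close>.\<close>
      proof (cases "(x, z) \<in> ord X")
        case True
        then obtain U where U: "U \<in> clopen_upsets Y" "(y \<in> U) \<noteq> (dual z \<in> U)"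
          using no target.point_eqI[OF yY dual_points[OF z]] by blast
        then show ?thesis
          using that[OF wholeX whole U(1) x yY] that[OF wholeX U(1) void x] z dual_iff[OF z U(1)]
          by (cases "y \<in> U") auto
      next
        case False
        then obtain W where "W \<in> clopen_upsets X" "x \<in> W" "z \<notin> W"
          using source.separation x z by blast
        then show ?thesis
          using that[OF _ whole void _ yY, of W] z by auto
      qed
      show "z \<in> \<Union>\<U>"
        using UnionI[OF mem[OF WUV(1-6)] WUV(7)] .
    qed
  qed
  then obtain W U V where WUV: "W \<in> clopen_upsets X" "x \<in> W" "U \<in> clopen_upsets Y" "V \<in> clopen_upsets Y"
    "y \<in> U" "y \<notin> V" and cov: "points X \<subseteq> (points X - W) \<union> h V \<union> (points X - h U)"
    unfolding \<U>_def by blast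
  have "W \<inter> h U \<subseteq> h V"
    using cov clopen_upset_subset[OF WUV(1)] by auto
  then have "W \<subseteq> h (clopen_imp Y U V)"
    unfolding imp[OF WUV(3,4)] source.clopen_imp_residual[OF WUV(1)] .
  then have "dual x \<in> clopen_imp Y U V"
    unfolding dual_iff[OF x target.clopen_imp_closed[OF WUV(3,4)]] using WUV(2) by blast
  then show False
    using y WUV(5,6) unfolding target.clopen_imp_mem_iff[OF dual_points[OF x]] by blast
qed

text \<open>Differences \<open>U - V\<close> of clopen up-sets form a basis of \<open>Y\<close>, and
  their preimages are the open sets \<open>h U - h V\<close>.\<close>

lemma dual_esakia: "dual \<in> esakia_functions X Y"
proof -
  have "openin (tau X) {x \<in> points X. dual x \<in> W}" if W: "openin (tau Y) W" for W
  proof (subst openin_subopen, intro ballI)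
    fix x assume "x \<in> {x \<in> points X. dual x \<in> W}"
    then have x: "x \<in> points X" "dual x \<in> W" by auto
    have "\<exists>U \<in> clopen_upsets Y. (dual x \<in> U) \<noteq> (y \<in> U)" if y: "y \<in> points Y - W" for y
    proof -
      have "dual x \<noteq> y"
        using x y by blast
      then show ?thesis
        using target.point_eqI[OF dual_points[OF x(1)], of y] y by blast
    qed
    then obtain U V where UV: "U \<in> clopen_upsets Y" "V \<in> clopen_upsets Y" "dual x \<in> U - V" "U - V \<subseteq> W"
      using target.clopen_upsets.basis[OF W x(2)] by blast
    have "openin (tau X) (h U - h V)"
      using UV(1,2) by (intro openin_diff source.clopen_upsets.clopen closed)
    moreover have "x \<in> h U - h V"
      using UV(3) x by (simp add: dual_iff UV(1,2))
    moreover have "h U - h V \<subseteq> {x \<in> points X. dual x \<in> W}"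
      using UV(4) dual_vimage[OF UV(1)] dual_vimage[OF UV(2)] by blast
    ultimately show "\<exists>T. openin (tau X) T \<and> x \<in> T \<and> T \<subseteq> {x \<in> points X. dual x \<in> W}"
      by blast
  qed
  then have "continuous_map (tau X) (tau Y) dual"
    using dual_points by (auto simp: continuous_map_def)
  moreover have "(dual x, dual y) \<in> ord Y" if xy: "(x, y) \<in> ord X" for x y
  proof -
    have "x \<in> points X" "y \<in> points X"
      using xy source.ord_points by auto
    then show ?thesis
      using source.upsetD[OF closed xy] by (simp add: target.ord_iff dual_points dual_iff)
  qed
  moreover have "up Y {dual x} \<subseteq> dual ` up X {x}" if x: "x \<in> points X" for x
  proof
    fix y assume "y \<in> up Y {dual x}"
    then obtain z where z: "(x, z) \<in> ord X" "dual z = y"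
      using dual_lift[OF x] by (auto simp: up_def)
    then have "z \<in> up X {x}"
      using source.ord_points by (auto simp: up_def)
    with z(2) show "y \<in> dual ` up X {x}"
      by blast
  qed
  moreover have "dual \<in> points X \<rightarrow>\<^sub>E points Y"
    using dual_points by (auto simp: dual_def)
  ultimately show ?thesis
    by (simp add: esakia_functions_def)
qed

end

section \<open>The algebra of clopen up-sets\<close>

lemma (in lattice) meet_eqI:
  assumes "a \<in> carrier L" "b \<in> carrier L" "m \<in> carrier L" "m \<sqsubseteq> a" "m \<sqsubseteq> b"
    and "\<And>c. \<lbrakk>c \<in> carrier L; c \<sqsubseteq> a; c \<sqsubseteq> b\<rbrakk> \<Longrightarrow> c \<sqsubseteq> m"
  shows "a \<sqinter> b = m"
  by (rule le_antisym)
    (simp_all add: assms(1-3) assms(6)[OF meet_closed meet_left meet_right] meet_le[OF assms(4,5)])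

lemma (in lattice) join_eqI:
  assumes "a \<in> carrier L" "b \<in> carrier L" "m \<in> carrier L" "a \<sqsubseteq> m" "b \<sqsubseteq> m"
    and "\<And>c. \<lbrakk>c \<in> carrier L; a \<sqsubseteq> c; b \<sqsubseteq> c\<rbrakk> \<Longrightarrow> m \<sqsubseteq> c"
  shows "a \<squnion> b = m"
  by (rule le_antisym)
    (simp_all add: assms(1-3) assms(6)[OF join_closed join_left join_right] join_le[OF assms(4,5)])

text \<open>The operations on sets are transported along \<open>i\<close>, because carriers have to
  lie in \<open>'a\<close>. Meet and join have no fields: the order determines them.\<close>

definition clopen_algebra :: "('p set \<Rightarrow> 'a) \<Rightarrow> 'p modal_esakia \<Rightarrow> 'a modal_heyting" where
  "clopen_algebra i X =
    (let dec = inv_into (clopen_upsets X) i in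
     \<lparr> carrier = i ` clopen_upsets X, eq = (=), le = (\<lambda>a b. dec a \<subseteq> dec b),
       imp = (\<lambda>a b. i (clopen_imp X (dec a) (dec b))),
       box = (\<lambda>a. i (box_of X (dec a))), dia = (\<lambda>a. i (dia_of X (dec a))) \<rparr>)"

locale encoded_modal_esakia_space =
  modal_esakia_space X for X :: "'p modal_esakia" +
  fixes i :: "'p set \<Rightarrow> 'a"
  assumes inj: "inj_on i (clopen_upsets X)"
begin

abbreviation A :: "'a modal_heyting" where
  "A \<equiv> clopen_algebra i X"

lemma carrier_A: "carrier A = i ` clopen_upsets X"
  and eq_A: "eq A = (=)"
  by (simp_all add: clopen_algebra_def Let_def)

lemma
  assumes U: "U \<in> clopen_upsets X"
  shows box_A: "box A (i U) = i (box_of X U)"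
    and dia_A: "dia A (i U) = i (dia_of X U)"
    and le_A: "V \<in> clopen_upsets X \<Longrightarrow> i U \<sqsubseteq>\<^bsub>A\<^esub> i V \<longleftrightarrow> U \<subseteq> V"
    and imp_A: "V \<in> clopen_upsets X \<Longrightarrow> imp A (i U) (i V) = i (clopen_imp X U V)"
  using U by (simp_all add: clopen_algebra_def Let_def inv_into_f_f[OF inj])

lemma partial_order_A: "partial_order A"
  by unfold_locales (auto simp: eq_A carrier_A le_A)

lemma meet_join_exists_A:
  assumes "U \<in> clopen_upsets X" "V \<in> clopen_upsets X"
  shows "greatest A (i (U \<inter> V)) (Lower A {i U, i V})"
    and "least A (i (U \<union> V)) (Upper A {i U, i V})"
  using assms clopen_upsets.Int[OF assms] clopen_upsets.Un[OF assms]
  by (auto simp: greatest_def least_def Lower_def Upper_def carrier_A le_A)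

lemma bottom_top_A: "least A (i {}) (carrier A)" "greatest A (i (points X)) (carrier A)"
  using clopen_upsets.empty clopen_upsets.whole clopen_upset_subset[where X = X]
  by (auto simp: greatest_def least_def carrier_A le_A)

lemma bounded_lattice_A: "Lattice.bounded_lattice A"
proof -
  interpret partial_order A by (rule partial_order_A)
  show ?thesis
  proof
    show "\<exists>s. least A s (Upper A {a, b})" if "a \<in> carrier A" "b \<in> carrier A" for a b
      using that meet_join_exists_A(2) by (auto simp: carrier_A)
    show "\<exists>s. greatest A s (Lower A {a, b})" if "a \<in> carrier A" "b \<in> carrier A" for a b
      using that meet_join_exists_A(1) by (auto simp: carrier_A)
    show "\<exists>x. least A x (carrier A)" "\<exists>x. greatest A x (carrier A)"
      using bottom_top_A by blast+
  qed
qed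

sublocale A: Lattice.bounded_lattice A
  by (rule bounded_lattice_A)

lemma bottom_A: "\<bottom>\<^bsub>A\<^esub> = i {}"
  by (rule A.least_unique[OF A.bottom_least bottom_top_A(1)])

lemma top_A: "\<top>\<^bsub>A\<^esub> = i (points X)"
  by (rule A.greatest_unique[OF A.top_greatest bottom_top_A(2)])

lemma meet_A:
  assumes "U \<in> clopen_upsets X" "V \<in> clopen_upsets X"
  shows "i U \<sqinter>\<^bsub>A\<^esub> i V = i (U \<inter> V)"
  using assms clopen_upsets.Int[OF assms] by (intro A.meet_eqI) (auto simp: carrier_A le_A)

lemma join_A:
  assumes "U \<in> clopen_upsets X" "V \<in> clopen_upsets X"
  shows "i U \<squnion>\<^bsub>A\<^esub> i V = i (U \<union> V)"
  using assms clopen_upsets.Un[OF assms] by (intro A.join_eqI) (auto simp: carrier_A le_A)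

lemma heyting_A: "heyting_algebra A"
proof
  show "imp A a b \<in> carrier A" if "a \<in> carrier A" "b \<in> carrier A" for a b
    using that clopen_imp_closed by (auto simp: carrier_A imp_A)
  show "c \<sqinter>\<^bsub>A\<^esub> a \<sqsubseteq>\<^bsub>A\<^esub> b \<longleftrightarrow> c \<sqsubseteq>\<^bsub>A\<^esub> imp A a b"
    if "a \<in> carrier A" "b \<in> carrier A" "c \<in> carrier A" for a b c
    using that by (auto simp: carrier_A meet_A imp_A le_A clopen_upsets.Int clopen_imp_closed
        clopen_imp_residual simp del: Diff_iff)
qed

lemma modal_heyting_A: "modal_heyting_algebra A"
proof -
  interpret heyting_algebra A by (rule heyting_A)
  show ?thesis
  proof
    show "box A a \<in> carrier A" "dia A a \<in> carrier A" if "a \<in> carrier A" for a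
      using that box_of_clopen dia_of_clopen by (auto simp: carrier_A box_A dia_A)
    show "box A a \<sqinter>\<^bsub>A\<^esub> dia A (neg A a \<sqinter>\<^bsub>A\<^esub> b) = \<bottom>\<^bsub>A\<^esub>"
      if ab: "a \<in> carrier A" "b \<in> carrier A" for a b
    proof -
      obtain U V where U: "U \<in> clopen_upsets X" "a = i U" and V: "V \<in> clopen_upsets X" "b = i V"
        using ab by (auto simp: carrier_A)
      have nU: "clopen_imp X U {} \<in> clopen_upsets X"
        by (rule clopen_imp_closed[OF U(1) clopen_upsets.empty])
      \<comment> \<open>The negation of \<open>U\<close> is the complement of its down-set. By De
        Morgan the set required to lie in \<open>eta2\<close> is thus the one whose absence defines
        the diamond of the meet of that negation with \<open>V\<close>.\<close>
      have "points X - (clopen_imp X U {} \<inter> V) = down X U \<union> (points X - V)"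
        by (auto simp: down_def)
      then have "box_of X U \<inter> dia_of X (clopen_imp X U {} \<inter> V) = {}"
        using eta1_eta2[OF _ U(1) V(1)] by (auto simp: box_of_def dia_of_def)
      then show ?thesis
        using U V nU by (simp add: neg_def bottom_A imp_A clopen_upsets.empty box_A dia_A meet_A
            clopen_upsets.Int box_of_clopen dia_of_clopen)
    qed
  qed
qed

end

section \<open>Inverse images along Esakia functions\<close>

lemma esakia_functionsD:
  assumes "f \<in> esakia_functions X Y"
  shows "x \<in> points X \<Longrightarrow> f x \<in> points Y"
    and "f \<in> points X \<rightarrow>\<^sub>E points Y"
    and "continuous_map (tau X) (tau Y) f"
    and "(x, y) \<in> ord X \<Longrightarrow> (f x, f y) \<in> ord Y"
    and "\<lbrakk>x \<in> points X; (f x, z) \<in> ord Y; z \<in> points Y\<rbrakk> \<Longrightarrow> \<exists>y. (x, y) \<in> ord X \<and> f y = z"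
proof -
  show "x \<in> points X \<Longrightarrow> f x \<in> points Y" "f \<in> points X \<rightarrow>\<^sub>E points Y"
    "continuous_map (tau X) (tau Y) f" "(x, y) \<in> ord X \<Longrightarrow> (f x, f y) \<in> ord Y"
    using assms by (auto simp: esakia_functions_def)
  assume "x \<in> points X" "(f x, z) \<in> ord Y" "z \<in> points Y"
  then have "z \<in> f ` up X {x}"
    using assms by (auto simp: esakia_functions_def up_def)
  then show "\<exists>y. (x, y) \<in> ord X \<and> f y = z"
    by (auto simp: up_def)
qed

lemma vimage_clopen_upset:
  assumes X: "esakia_space X" and f: "f \<in> esakia_functions X Y" and U: "U \<in> clopen_upsets Y"
  shows "f -` U \<inter> points X \<in> clopen_upsets X"
proof -
  interpret esakia_space X by fact
  have eq: "f -` U \<inter> points X = {x \<in> points X. f x \<in> U}"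
    by blast
  have "openin (tau X) (f -` U \<inter> points X)" "closedin (tau X) (f -` U \<inter> points X)"
    unfolding eq
    by (rule openin_continuous_map_preimage[OF esakia_functionsD(3)[OF f] clopen_upset_open[OF U]])
      (rule closedin_continuous_map_preimage[OF esakia_functionsD(3)[OF f] clopen_upset_closed[OF U]])
  moreover have "y \<in> f -` U \<inter> points X" if "x \<in> f -` U \<inter> points X" "(x, y) \<in> ord X" for x y
  proof -
    have "(f x, f y) \<in> ord Y" "f y \<in> points Y"
      using that esakia_functionsD(1,4)[OF f] ord_points by blast+
    then have "f y \<in> U"
      using that(1) U unfolding clopen_upsets_iff by blast
    then show ?thesis
      using that(2) ord_points by blast
  qed
  ultimately show ?thesis
    unfolding clopen_upsets_iff by blast
qed

text \<open>Monotonicity and the back condition identify the points above \<open>f x\<close> with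
  the images of the points above \<open>x\<close>, so both sides quantify over the same
  points.\<close>

lemma vimage_clopen_imp:
  assumes X: "esakia_space X" and Y: "esakia_space Y" and f: "f \<in> esakia_functions X Y"
  shows "f -` clopen_imp Y U V \<inter> points X = clopen_imp X (f -` U \<inter> points X) (f -` V \<inter> points X)"
proof (rule Set.set_eqI)
  fix x
  interpret X: esakia_space X by fact
  interpret Y: esakia_space Y by fact
  show "x \<in> f -` clopen_imp Y U V \<inter> points X \<longleftrightarrow>
      x \<in> clopen_imp X (f -` U \<inter> points X) (f -` V \<inter> points X)"
  proof (cases "x \<in> points X")
    case True
    have "(\<forall>z. (f x, z) \<in> ord Y \<longrightarrow> z \<in> U \<longrightarrow> z \<in> V) \<longleftrightarrow>
        (\<forall>y. (x, y) \<in> ord X \<longrightarrow> f y \<in> U \<longrightarrow> f y \<in> V)"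
      using esakia_functionsD(4)[OF f] esakia_functionsD(5)[OF f True] Y.ord_points(2) by metis
    moreover have "f x \<in> clopen_imp Y U V \<longleftrightarrow> (\<forall>z. (f x, z) \<in> ord Y \<longrightarrow> z \<in> U \<longrightarrow> z \<in> V)"
      by (rule Y.clopen_imp_mem_iff[OF esakia_functionsD(1)[OF f True]])
    ultimately show ?thesis
      unfolding X.clopen_imp_mem_iff[OF True] using True X.ord_points(2) by blast
  qed auto
qed

lemma vimage_clopen_upset_hom:
  assumes X: "esakia_space X" and Y: "esakia_space Y" and f: "f \<in> esakia_functions X Y"
  shows "clopen_upset_hom X Y (\<lambda>U. f -` U \<inter> points X)"
proof -
  interpret X: esakia_space X by fact
  interpret Y: esakia_space Y by fact
  show ?thesis
    by unfold_locales
      (use esakia_functionsD(1)[OF f] in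
        \<open>auto simp: vimage_clopen_upset[OF X f] vimage_clopen_imp[OF X Y f] simp del: Diff_iff vimage_Diff\<close>)
qed

text \<open>Collecting the pointwise conditions on \<open>eta1\<close> and \<open>eta2\<close> over
  all \<open>x\<close> turns them into equations of sets, the form in which homomorphisms preserve
  box and diamond.\<close>

lemma me_hom_iff:
  assumes "f \<in> esakia_functions X Y"
  shows "f \<in> me_hom X Y \<longleftrightarrow> (\<forall>U \<in> clopen_upsets Y.
    f -` box_of Y U \<inter> points X = box_of X (f -` U \<inter> points X) \<and>
    f -` dia_of Y U \<inter> points X = dia_of X (f -` U \<inter> points X))"
proof -
  have box: "f -` box_of Y U \<inter> points X = box_of X (f -` U \<inter> points X) \<longleftrightarrow>
      (\<forall>x \<in> points X. U \<in> eta1 Y (f x) \<longleftrightarrow> f -` U \<inter> points X \<in> eta1 X x)" for U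
    using esakia_functionsD(1)[OF assms] unfolding box_of_def by blast
  have dia: "f -` dia_of Y U \<inter> points X = dia_of X (f -` U \<inter> points X) \<longleftrightarrow>
      (\<forall>x \<in> points X. points Y - U \<in> eta2 Y (f x) \<longleftrightarrow> points X - f -` U \<in> eta2 X x)" for U
  proof -
    have "points X - (f -` U \<inter> points X) = points X - f -` U"
      by blast
    then show ?thesis
      using esakia_functionsD(1)[OF assms] unfolding dia_of_def by auto
  qed
  show ?thesis
    unfolding box dia me_hom_def using assms by blast
qed

locale encoded_spaces =
  X: encoded_modal_esakia_space X i + Y: encoded_modal_esakia_space Y j
  for X :: "'p modal_esakia" and i :: "'p set \<Rightarrow> 'a" and Y :: "'p modal_esakia" and j :: "'p set \<Rightarrow> 'a"
begin

definition encode :: "('p set \<Rightarrow> 'p set) \<Rightarrow> 'a \<Rightarrow> 'a" where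
  "encode h = (\<lambda>a \<in> j ` clopen_upsets Y. i (h (inv_into (clopen_upsets Y) j a)))"

lemma encode_apply: "U \<in> clopen_upsets Y \<Longrightarrow> encode h (j U) = i (h U)"
  by (simp add: encode_def inv_into_f_f[OF Y.inj])

text \<open>All sets involved are clopen up-sets of \<open>X\<close>, where \<open>i\<close> is
  injective; every equation between codes is therefore the same equation between sets.\<close>

lemma encode_hom_iff:
  assumes h: "\<And>U. U \<in> clopen_upsets Y \<Longrightarrow> h U \<in> clopen_upsets X"
  shows "encode h \<in> mh_hom Y.A X.A \<longleftrightarrow> clopen_upset_hom X Y h \<and>
    (\<forall>U \<in> clopen_upsets Y. h (box_of Y U) = box_of X (h U) \<and> h (dia_of Y U) = dia_of X (h U))"
proof -
  note i_eq = inj_on_eq_iff[OF X.inj]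
  note closed = X.clopen_upsets.empty X.clopen_upsets.whole X.clopen_upsets.Int X.clopen_upsets.Un
    X.clopen_imp_closed X.box_of_clopen X.dia_of_clopen
    Y.clopen_upsets.empty Y.clopen_upsets.whole Y.clopen_upsets.Int Y.clopen_upsets.Un
    Y.clopen_imp_closed Y.box_of_clopen Y.dia_of_clopen h
  have "encode h \<in> carrier Y.A \<rightarrow>\<^sub>E carrier X.A"
    using h by (auto simp: encode_def Y.carrier_A X.carrier_A inv_into_f_f[OF Y.inj])
  moreover have "clopen_upset_hom X Y h \<longleftrightarrow> h {} = {} \<and> h (points Y) = points X \<and>
    (\<forall>U \<in> clopen_upsets Y. \<forall>V \<in> clopen_upsets Y. h (U \<inter> V) = h U \<inter> h V \<and> h (U \<union> V) = h U \<union> h V \<and>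
      h (clopen_imp Y U V) = clopen_imp X (h U) (h V))"
    (is "_ \<longleftrightarrow> ?preserves")
  proof
    assume "clopen_upset_hom X Y h"
    then interpret hom: clopen_upset_hom X Y h .
    show ?preserves
      by (simp add: hom.empty hom.points hom.Int hom.Un hom.imp del: Diff_iff)
  next
    assume ?preserves
    then show "clopen_upset_hom X Y h"
      by unfold_locales (simp_all add: h)
  qed
  ultimately show ?thesis
    by (simp add: mh_hom_def Y.carrier_A X.bottom_A Y.bottom_A X.top_A Y.top_A
        X.meet_A Y.meet_A X.join_A Y.join_A X.imp_A Y.imp_A X.box_A Y.box_A X.dia_A Y.dia_A
        encode_apply closed i_eq del: Diff_iff)
qed

definition pullback :: "('p \<Rightarrow> 'p) \<Rightarrow> 'a \<Rightarrow> 'a" where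
  "pullback f = encode (\<lambda>U. f -` U \<inter> points X)"

text \<open>Injectivity holds because clopen up-sets separate the points of \<open>Y\<close>. For
  surjectivity, decode \<open>k\<close> to a map \<open>h\<close> of sets; the inverse image map of
  its dual is \<open>h\<close> again.\<close>

lemma pullback_bij: "bij_betw pullback (me_hom X Y) (mh_hom Y.A X.A)"
  unfolding bij_betw_def
proof (intro conjI inj_onI equalityI subsetI)
  fix f g assume f: "f \<in> me_hom X Y" and g: "g \<in> me_hom X Y" and eq: "pullback f = pullback g"
  have fE: "f \<in> esakia_functions X Y" and gE: "g \<in> esakia_functions X Y"
    using f g by (auto simp: me_hom_def)
  have vim: "f -` U \<inter> points X = g -` U \<inter> points X" if U: "U \<in> clopen_upsets Y" for U
  proof (rule inj_onD[OF X.inj])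
    show "i (f -` U \<inter> points X) = i (g -` U \<inter> points X)"
      using fun_cong[OF eq, of "j U"] by (simp add: pullback_def encode_apply[OF U])
  qed (use U in \<open>auto intro: vimage_clopen_upset[OF X.esakia_space_axioms] fE gE\<close>)
  have "f x = g x" if x: "x \<in> points X" for x
  proof (rule Y.point_eqI[OF esakia_functionsD(1)[OF fE x] esakia_functionsD(1)[OF gE x]])
    show "f x \<in> U \<longleftrightarrow> g x \<in> U" if "U \<in> clopen_upsets Y" for U
      using vim[OF that] x by blast
  qed
  then show "f = g"
    using esakia_functionsD(2)[OF fE] esakia_functionsD(2)[OF gE] by (metis PiE_ext)
next
  fix k assume "k \<in> pullback ` me_hom X Y"
  then obtain f where f: "f \<in> me_hom X Y" and k: "k = pullback f"
    by blast
  have fE: "f \<in> esakia_functions X Y"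
    using f by (simp add: me_hom_def)
  show "k \<in> mh_hom Y.A X.A"
    unfolding k pullback_def
    by (subst encode_hom_iff)
      (use f in \<open>simp_all add: vimage_clopen_upset[OF X.esakia_space_axioms fE] me_hom_iff[OF fE]
        vimage_clopen_upset_hom[OF X.esakia_space_axioms Y.esakia_space_axioms fE]\<close>)
next
  fix k assume k: "k \<in> mh_hom Y.A X.A"
  have kC: "k (j U) \<in> i ` clopen_upsets X" if "U \<in> clopen_upsets Y" for U
    using k that by (auto simp: mh_hom_def Y.carrier_A X.carrier_A)
  define h where "h U = inv_into (clopen_upsets X) i (k (j U))" for U
  have h: "h U \<in> clopen_upsets X" "i (h U) = k (j U)" if "U \<in> clopen_upsets Y" for U
    using kC[OF that] unfolding h_def by (rule inv_into_into, rule f_inv_into_f)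
  have "k = encode h"
  proof
    fix a
    show "k a = encode h a"
    proof (cases "a \<in> j ` clopen_upsets Y")
      case True
      then show ?thesis
        using h(2) encode_apply by auto
    next
      case False
      then show ?thesis
        using k by (auto simp: mh_hom_def encode_def Y.carrier_A PiE_def extensional_def)
    qed
  qed
  with k have hom: "clopen_upset_hom X Y h"
    and modal: "\<And>U. U \<in> clopen_upsets Y \<Longrightarrow> h (box_of Y U) = box_of X (h U) \<and> h (dia_of Y U) = dia_of X (h U)"
    using encode_hom_iff[of h] h(1) by auto
  interpret hom: clopen_upset_hom X Y h by (rule hom)
  have "hom.dual \<in> me_hom X Y"
    unfolding me_hom_iff[OF hom.dual_esakia]
    using modal by (simp add: hom.dual_vimage Y.box_of_clopen Y.dia_of_clopen)
  moreover have "k = pullback hom.dual"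
  proof -
    have "encode h = encode (\<lambda>U. hom.dual -` U \<inter> points X)"
      unfolding encode_def by (rule restrict_ext) (auto simp: inv_into_f_f[OF Y.inj] hom.dual_vimage)
    then show ?thesis
      using \<open>k = encode h\<close> by (simp add: pullback_def)
  qed
  ultimately show "k \<in> pullback ` me_hom X Y"
    by blast
qed

end

section \<open>The prime spectrum\<close>

text \<open>Prime filters have type \<open>'a set\<close>, but points must have type
  \<open>'p\<close>. The points are therefore labels in a set \<open>S\<close>, and \<open>e\<close>
  returns the filter that a label stands for.\<close>

locale heyting_spectrum =
  modal_heyting_algebra H for H :: "'a modal_heyting" (structure) +
  fixes S :: "'p set" and e :: "'p \<Rightarrow> 'a set"
  assumes bij: "bij_betw e S (prime_filters H)"
begin

definition basic :: "'a \<Rightarrow> 'p set" where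
  "basic a = {x \<in> S. a \<in> e x}"

lemma e_filter: "x \<in> S \<Longrightarrow> lattice_filter H (e x)"
  and bottom_e: "x \<in> S \<Longrightarrow> \<bottom> \<notin> e x"
  and join_e: "\<lbrakk>x \<in> S; a \<in> carrier H; b \<in> carrier H; a \<squnion> b \<in> e x\<rbrakk> \<Longrightarrow> a \<in> e x \<or> b \<in> e x"
  using bij_betwE[OF bij] by (auto simp: prime_filters_def)

lemma e_le: "\<lbrakk>x \<in> S; a \<in> e x; a \<sqsubseteq> b; b \<in> carrier H\<rbrakk> \<Longrightarrow> b \<in> e x"
  using lattice_filterD(3)[OF e_filter] .

lemma point_exists:
  assumes F: "lattice_filter H F" and I: "lattice_ideal H I" and FI: "F \<inter> I = {}"
  obtains x where "x \<in> S" "F \<subseteq> e x" "e x \<inter> I = {}"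
proof -
  obtain P where P: "P \<in> prime_filters H" "F \<subseteq> P" "P \<inter> I = {}"
    using prime_filter_exists[OF F I FI] .
  then obtain x where "x \<in> S" "e x = P"
    using P(1) unfolding bij_betw_imp_surj_on[OF bij, symmetric] by (elim imageE) simp
  then show ?thesis
    using that P by blast
qed

text \<open>By residuation, \<open>m \<sqinter> a \<sqsubseteq> b\<close> with
  \<open>m \<in> F\<close> would put \<open>imp H a b\<close> into \<open>F\<close>. Hence the
  filter generated by \<open>F\<close> and \<open>a\<close> is disjoint from the ideal below
  \<open>b\<close>, and a prime filter separates them.\<close>

lemma point_extending:
  assumes F: "lattice_filter H F" and a: "a \<in> carrier H" and b: "b \<in> carrier H"
    and no: "imp H a b \<notin> F"
  obtains x where "x \<in> S" "F \<subseteq> e x" "a \<in> e x" "b \<notin> e x"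
proof -
  let ?G = "{c \<in> carrier H. \<exists>m \<in> F. m \<sqinter> a \<sqsubseteq> c}" and ?I = "{c \<in> carrier H. c \<sqsubseteq> b}"
  note ext = lattice_filter_extend[OF F a]
  have "\<not> m \<sqinter> a \<sqsubseteq> b" if m: "m \<in> F" for m
    using lattice_filterD(1,3)[OF F] m no a b imp_residual imp_closed by metis
  then have "\<not> c \<sqsubseteq> b" if c: "c \<in> carrier H" "m \<in> F" "m \<sqinter> a \<sqsubseteq> c" for c m
    using c le_trans[OF c(3), of b] a b lattice_filterD(1)[OF F c(2)] meet_closed by blast
  then have "?G \<inter> ?I = {}"
    by blast
  then obtain x where "x \<in> S" "?G \<subseteq> e x" "e x \<inter> ?I = {}"
    using point_exists[OF ext(1) lattice_ideal_principal[OF b]] by blast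
  moreover have "b \<in> ?I"
    using b by auto
  ultimately show ?thesis
    using that ext(2,3) by blast
qed

lemma basic_subset: "basic a \<subseteq> S"
  by (auto simp: basic_def)

lemma basic_top: "basic \<top> = S"
  using lattice_filterD(2)[OF e_filter] by (auto simp: basic_def)

lemma basic_bottom: "basic \<bottom> = {}"
  using bottom_e by (auto simp: basic_def)

lemma
  assumes a: "a \<in> carrier H" and b: "b \<in> carrier H"
  shows basic_meet: "basic (a \<sqinter> b) = basic a \<inter> basic b"
    and basic_join: "basic (a \<squnion> b) = basic a \<union> basic b"
proof -
  have "a \<sqinter> b \<in> e x \<longleftrightarrow> a \<in> e x \<and> b \<in> e x" if "x \<in> S" for x
    using lattice_filterD(4)[OF e_filter[OF that]] e_le[OF that _ meet_left[OF a b] a]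
      e_le[OF that _ meet_right[OF a b] b] by blast
  then show "basic (a \<sqinter> b) = basic a \<inter> basic b"
    by (auto simp: basic_def)
  have "a \<squnion> b \<in> e x \<longleftrightarrow> a \<in> e x \<or> b \<in> e x" if "x \<in> S" for x
    using join_e[OF that a b] e_le[OF that _ join_left[OF a b] join_closed[OF a b]]
      e_le[OF that _ join_right[OF a b] join_closed[OF a b]] by blast
  then show "basic (a \<squnion> b) = basic a \<union> basic b"
    by (auto simp: basic_def)
qed

text \<open>If \<open>a\<close> is not below \<open>b\<close>, the principal filter of
  \<open>a\<close> and the principal ideal of \<open>b\<close> are disjoint, and a prime filter
  separating them gives a point of \<open>basic a - basic b\<close>.\<close>

lemma basic_subset_iff:
  assumes a: "a \<in> carrier H" and b: "b \<in> carrier H"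
  shows "basic a \<subseteq> basic b \<longleftrightarrow> a \<sqsubseteq> b"
proof
  assume sub: "basic a \<subseteq> basic b"
  show "a \<sqsubseteq> b"
  proof (rule ccontr)
    assume nle: "\<not> a \<sqsubseteq> b"
    let ?F = "{c \<in> carrier H. a \<sqsubseteq> c}" and ?I = "{c \<in> carrier H. c \<sqsubseteq> b}"
    have "lattice_filter H ?F"
      using a by (intro lattice_filterI) (auto intro: le_trans meet_le top_higher)
    moreover have "?F \<inter> ?I = {}"
      using nle a b le_trans by blast
    ultimately obtain x where "x \<in> S" "?F \<subseteq> e x" "e x \<inter> ?I = {}"
      using point_exists lattice_ideal_principal[OF b] by blast
    then have "x \<in> basic a" "x \<notin> basic b"
      using a b by (auto simp: basic_def)
    then show False
      using sub by blast
  qed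
qed (use e_le b in \<open>auto simp: basic_def\<close>)

lemma inj_basic: "inj_on basic (carrier H)"
  by (rule inj_onI) (metis basic_subset_iff le_antisym subset_refl)

text \<open>Complements are included so that basic sets become clopen; this generates the Priestley
  topology.\<close>

definition subbase :: "'p set set" where
  "subbase = basic ` carrier H \<union> (\<lambda>a. S - basic a) ` carrier H"

text \<open>The topology has the form in which Alexander's subbase theorem speaks of it.\<close>

definition spectrum :: "'p modal_esakia" where
  "spectrum = \<lparr> tau = topology (arbitrary union_of (finite intersection_of (\<lambda>U. U \<in> subbase) relative_to S)),
     ord = {(x, y) \<in> S \<times> S. e x \<subseteq> e y},
     eta1 = (\<lambda>x. {basic a | a. a \<in> carrier H \<and> box H a \<in> e x}),
     eta2 = (\<lambda>x. {S - basic a | a. a \<in> carrier H \<and> dia H a \<notin> e x}) \<rparr>"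

lemma points_spectrum: "points spectrum = S"
  by (simp add: spectrum_def topspace_subbase)

lemma ord_spectrum: "(x, y) \<in> ord spectrum \<longleftrightarrow> x \<in> S \<and> y \<in> S \<and> e x \<subseteq> e y"
  by (simp add: spectrum_def)

lemma eta_spectrum:
  "eta1 spectrum x = {basic a | a. a \<in> carrier H \<and> box H a \<in> e x}"
  "eta2 spectrum x = {S - basic a | a. a \<in> carrier H \<and> dia H a \<notin> e x}"
  by (simp_all add: spectrum_def)

lemma subbase_open: "U \<in> subbase \<Longrightarrow> openin (tau spectrum) U"
proof -
  assume U: "U \<in> subbase"
  then have "U = S \<inter> U"
    by (auto simp: subbase_def basic_def)
  moreover have "openin (tau spectrum) (S \<inter> U)"
    unfolding spectrum_def modal_esakia.simps openin_subbase
    by (intro arbitrary_union_of_inc relative_to_inc finite_intersection_of_inc U)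
  ultimately show ?thesis
    by simp
qed

lemma basic_clopen:
  assumes "a \<in> carrier H"
  shows "openin (tau spectrum) (basic a)" "closedin (tau spectrum) (basic a)"
  using assms subbase_open[of "basic a"] subbase_open[of "S - basic a"] basic_subset
  by (auto simp: subbase_def closedin_def points_spectrum)

text \<open>By Alexander's theorem it suffices to treat a cover \<open>C\<close> by subbasic sets.
  Without a finite subcover, the filter \<open>F\<close> and the ideal \<open>I\<close> below are
  disjoint, and a prime filter separating them is a point that \<open>C\<close> misses.\<close>

theorem compact_spectrum: "compact_space (tau spectrum)"
proof (rule Alexander_subbase_alt[where U = S and \<B> = subbase])
  show "S \<subseteq> \<Union>subbase"
    using basic_top by (auto simp: subbase_def)
  show "topology (arbitrary union_of (finite intersection_of (\<lambda>U. U \<in> subbase) relative_to S)) = tau spectrum"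
    by (simp add: spectrum_def)
  fix C assume C: "C \<subseteq> subbase" "S \<subseteq> \<Union>C"
  \<comment> \<open>\<open>F\<close> collects the \<open>c\<close> for which finitely many members
    of \<open>C\<close> cover the complement of \<open>basic c\<close>, and \<open>I\<close> those
    for which finitely many cover \<open>basic c\<close> itself. A common element would give a
    finite subcover.\<close>
  define F where "F = {c \<in> carrier H. \<exists>D. finite D \<and> D \<subseteq> C \<and> S \<subseteq> \<Union>D \<union> basic c}"
  define I where "I = {c \<in> carrier H. \<exists>D. finite D \<and> D \<subseteq> C \<and> basic c \<subseteq> \<Union>D}"
  show "\<exists>C'. finite C' \<and> C' \<subseteq> C \<and> S \<subseteq> \<Union>C'"
  proof (rule ccontr)
    assume no: "\<not> ?thesis"
    have FI: "F \<inter> I = {}"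
    proof (rule ccontr)
      assume "F \<inter> I \<noteq> {}"
      then obtain c where "c \<in> F" "c \<in> I"
        by blast
      then obtain D E where "finite D" "D \<subseteq> C" "S \<subseteq> \<Union>D \<union> basic c" "finite E" "E \<subseteq> C" "basic c \<subseteq> \<Union>E"
        unfolding F_def I_def by blast
      then have "finite (D \<union> E)" "D \<union> E \<subseteq> C" "S \<subseteq> \<Union>(D \<union> E)"
        by auto
      then show False
        using no by blast
    qed
    have F: "lattice_filter H F"
    proof (rule lattice_filterI)
      show "F \<subseteq> carrier H"
        by (auto simp: F_def)
      show "\<top> \<in> F"
        using basic_top by (auto simp: F_def intro!: exI[of _ "{}"])
      show "b \<in> F" if a: "a \<in> F" and b: "b \<in> carrier H" and ab: "a \<sqsubseteq> b" for a b
      proof -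
        obtain D where "finite D" "D \<subseteq> C" "S \<subseteq> \<Union>D \<union> basic a" "a \<in> carrier H"
          using a unfolding F_def by blast
        moreover from this have "basic a \<subseteq> basic b"
          using b ab by (simp add: basic_subset_iff)
        ultimately have "finite D \<and> D \<subseteq> C \<and> S \<subseteq> \<Union>D \<union> basic b"
          by blast
        then show ?thesis
          using b unfolding F_def by blast
      qed
      show "a \<sqinter> b \<in> F" if a: "a \<in> F" and b: "b \<in> F" for a b
      proof -
        obtain D E where DE: "finite D" "D \<subseteq> C" "S \<subseteq> \<Union>D \<union> basic a" "finite E" "E \<subseteq> C" "S \<subseteq> \<Union>E \<union> basic b"
          using a b unfolding F_def by blast
        have ab: "a \<in> carrier H" "b \<in> carrier H"
          using a b by (auto simp: F_def)
        have "finite (D \<union> E) \<and> D \<union> E \<subseteq> C \<and> S \<subseteq> \<Union>(D \<union> E) \<union> basic (a \<sqinter> b)"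
          using DE unfolding basic_meet[OF ab] by auto
        then show ?thesis
          using meet_closed[OF ab] unfolding F_def by blast
      qed
    qed
    have I: "lattice_ideal H I"
      unfolding lattice_ideal_def
    proof (intro conjI ballI impI)
      show "I \<subseteq> carrier H"
        by (auto simp: I_def)
      show "\<bottom> \<in> I"
        using basic_bottom by (auto simp: I_def intro!: exI[of _ "{}"])
      show "b \<in> I" if a: "a \<in> I" and b: "b \<in> carrier H" and ba: "b \<sqsubseteq> a" for a b
      proof -
        obtain D where "finite D" "D \<subseteq> C" "basic a \<subseteq> \<Union>D" "a \<in> carrier H"
          using a unfolding I_def by blast
        moreover from this have "basic b \<subseteq> basic a"
          using b ba by (simp add: basic_subset_iff)
        ultimately have "finite D \<and> D \<subseteq> C \<and> basic b \<subseteq> \<Union>D"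
          by blast
        then show ?thesis
          using b unfolding I_def by blast
      qed
      show "a \<squnion> b \<in> I" if a: "a \<in> I" and b: "b \<in> I" for a b
      proof -
        obtain D E where DE: "finite D" "D \<subseteq> C" "basic a \<subseteq> \<Union>D" "finite E" "E \<subseteq> C" "basic b \<subseteq> \<Union>E"
          using a b unfolding I_def by blast
        have ab: "a \<in> carrier H" "b \<in> carrier H"
          using a b by (auto simp: I_def)
        have "finite (D \<union> E) \<and> D \<union> E \<subseteq> C \<and> basic (a \<squnion> b) \<subseteq> \<Union>(D \<union> E)"
          using DE unfolding basic_join[OF ab] by auto
        then show ?thesis
          using join_closed[OF ab] unfolding I_def by blast
      qed
    qed
    obtain x where x: "x \<in> S" "F \<subseteq> e x" "e x \<inter> I = {}"
      using point_exists[OF F I FI] .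
    \<comment> \<open>If \<open>D\<close> is \<open>basic a\<close>, then \<open>a\<close> lies in
      \<open>I\<close> and in \<open>e x\<close>; if \<open>D\<close> is its complement, then
      \<open>a\<close> lies in \<open>F\<close> but not in \<open>e x\<close>. Both contradict the
      choice of \<open>x\<close>.\<close>
    obtain D where D: "D \<in> C" "x \<in> D"
      using C(2) x(1) by blast
    then consider a where "a \<in> carrier H" "D = basic a" | a where "a \<in> carrier H" "D = S - basic a"
      using C(1) unfolding subbase_def by blast
    then show False
    proof cases
      case 1
      then have "finite {D} \<and> {D} \<subseteq> C \<and> basic a \<subseteq> \<Union>{D}"
        using D by auto
      then have "a \<in> I"
        using 1 unfolding I_def by blast
      then show False
        using 1 D(2) x(3) by (auto simp: basic_def)
    next
      case 2
      then have "finite {D} \<and> {D} \<subseteq> C \<and> S \<subseteq> \<Union>{D} \<union> basic a"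
        using D by auto
      then have "a \<in> F"
        using 2 unfolding F_def by blast
      then show False
        using 2 D(2) x(1,2) by (auto simp: basic_def)
    qed
  qed
qed

sublocale basic: clopen_lattice "tau spectrum" "basic ` carrier H"
proof
  show "compact_space (tau spectrum)"
    by (rule compact_spectrum)
  show "openin (tau spectrum) U" "closedin (tau spectrum) U" if "U \<in> basic ` carrier H" for U
    using that basic_clopen by auto
  show "{} \<in> basic ` carrier H"
    using basic_bottom by (metis bottom_closed image_eqI)
  show "points spectrum \<in> basic ` carrier H"
    unfolding points_spectrum using basic_top by (metis top_closed image_eqI)
  show "U \<union> V \<in> basic ` carrier H" if "U \<in> basic ` carrier H" "V \<in> basic ` carrier H" for U V
    using that by (elim imageE) (simp add: basic_join[symmetric])
  show "U \<inter> V \<in> basic ` carrier H" if "U \<in> basic ` carrier H" "V \<in> basic ` carrier H" for U V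
    using that by (elim imageE) (simp add: basic_meet[symmetric])
qed

lemma ord_separation:
  assumes "x \<in> S" "y \<in> S" "(x, y) \<notin> ord spectrum"
  shows "\<exists>U \<in> basic ` carrier H. x \<in> U \<and> y \<notin> U"
proof -
  obtain a where "a \<in> e x" "a \<notin> e y"
    using assms by (auto simp: ord_spectrum)
  moreover from this have "a \<in> carrier H"
    using lattice_filterD(1)[OF e_filter[OF assms(1)]] by blast
  ultimately show ?thesis
    using assms by (intro bexI[of _ "basic a"]) (auto simp: basic_def)
qed

lemma basic_clopen_upset: "a \<in> carrier H \<Longrightarrow> basic a \<in> clopen_upsets spectrum"
  using basic_clopen by (auto simp: clopen_upsets_def clopens_def up_def ord_spectrum basic_def)

text \<open>The order is inclusion of filters, so a point of an up-set \<open>W\<close> and a point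
  outside it are separated by a basic set; \<open>clopen_mem\<close> then shows that
  \<open>W\<close> is basic.\<close>

lemma clopen_upsets_spectrum: "clopen_upsets spectrum = basic ` carrier H"
proof (intro equalityI subsetI)
  fix W assume W: "W \<in> clopen_upsets spectrum"
  show "W \<in> basic ` carrier H"
  proof (rule basic.clopen_mem[OF clopen_upset_open[OF W] clopen_upset_closed[OF W]])
    fix x y assume xy: "x \<in> W" "y \<in> points spectrum - W"
    then have "(x, y) \<notin> ord spectrum"
      using W unfolding clopen_upsets_iff by blast
    then show "\<exists>U \<in> basic ` carrier H. x \<in> U \<and> y \<notin> U"
      using ord_separation xy clopen_upset_subset[OF W] by (simp add: points_spectrum)
  qed
qed (auto intro: basic_clopen_upset)

lemma partial_order_spectrum: "partial_order_on (points spectrum) (ord spectrum)"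
proof -
  have "x = y" if "x \<in> S" "y \<in> S" "e x = e y" for x y
    using that bij_betw_imp_inj_on[OF bij] by (simp add: inj_on_eq_iff)
  then show ?thesis
    by (auto simp: partial_order_on_def preorder_on_def refl_on_def trans_def antisym_def
        points_spectrum ord_spectrum)
qed

text \<open>One inclusion is modus ponens inside a larger filter. For the other, a missing
  implication is refuted by a prime filter above \<open>e x\<close> that contains \<open>a\<close>
  and omits \<open>b\<close>.\<close>

lemma basic_imp:
  assumes a: "a \<in> carrier H" and b: "b \<in> carrier H"
  shows "basic (imp H a b) = clopen_imp spectrum (basic a) (basic b)"
proof (intro equalityI subsetI)
  fix x assume x: "x \<in> basic (imp H a b)"
  then have xS: "x \<in> S" and ix: "imp H a b \<in> e x"
    by (auto simp: basic_def)
  have "b \<in> e y" if y: "y \<in> S" "e x \<subseteq> e y" "a \<in> e y" for y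
  proof -
    have "imp H a b \<sqinter> a \<in> e y"
      using lattice_filterD(4)[OF e_filter[OF y(1)]] ix y by blast
    then show ?thesis
      using e_le[OF y(1) _ imp_meet_le[OF a b] b] by blast
  qed
  then show "x \<in> clopen_imp spectrum (basic a) (basic b)"
    using xS by (auto simp: points_spectrum down_def ord_spectrum basic_def)
next
  fix x assume x: "x \<in> clopen_imp spectrum (basic a) (basic b)"
  then have xS: "x \<in> S"
    by (simp add: points_spectrum)
  show "x \<in> basic (imp H a b)"
  proof (rule ccontr)
    assume "x \<notin> basic (imp H a b)"
    then have "imp H a b \<notin> e x"
      using xS by (simp add: basic_def)
    then obtain y where "y \<in> S" "e x \<subseteq> e y" "a \<in> e y" "b \<notin> e y"
      using point_extending[OF e_filter[OF xS] a b] by blast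
    then have "x \<in> down spectrum (basic a - basic b)"
      using xS by (auto simp: down_def points_spectrum ord_spectrum basic_def)
    then show False
      using x by blast
  qed
qed

text \<open>By \<open>basic_imp\<close> this down-set is the complement of a basic set.\<close>

lemma down_basic_clopen:
  assumes "a \<in> carrier H" "b \<in> carrier H"
  shows "down spectrum (basic a - basic b) \<in> clopens spectrum"
proof -
  have "down spectrum (basic a - basic b) = points spectrum - basic (imp H a b)"
    unfolding basic_imp[OF assms] by (auto simp: down_def)
  then show ?thesis
    using basic_clopen[OF imp_closed[OF assms]] by (auto simp: clopens_def intro: openin_diff closedin_diff)
qed

text \<open>A clopen set is a finite union of differences of basic sets, and \<open>down\<close> commutes with unions.\<close>

lemma down_clopen_spectrum:
  assumes U: "U \<in> clopens spectrum"
  shows "down spectrum U \<in> clopens spectrum"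
proof -
  have Uo: "openin (tau spectrum) U" "closedin (tau spectrum) U"
    using U by (auto simp: clopens_def)
  define \<U> where "\<U> = {D. D \<subseteq> U \<and> openin (tau spectrum) D \<and> down spectrum D \<in> clopens spectrum}"
  have "\<exists>D \<in> \<U>. U \<subseteq> D"
  proof (rule compact_space_directed_cover[OF compact_spectrum Uo(2)])
    show "openin (tau spectrum) D" if "D \<in> \<U>" for D
      using that by (simp add: \<U>_def)
    have "{} \<in> \<U>"
      by (simp add: \<U>_def down_def clopens_def)
    then show "\<U> \<noteq> {}"
      by blast
    show "\<exists>F \<in> \<U>. D \<union> E \<subseteq> F" if "D \<in> \<U>" "E \<in> \<U>" for D E
    proof (rule bexI)
      have "down spectrum (D \<union> E) = down spectrum D \<union> down spectrum E"
        by (auto simp: down_def)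
      then show "D \<union> E \<in> \<U>"
        using that by (auto simp: \<U>_def clopens_def intro: openin_Un closedin_Un)
    qed simp
    show "U \<subseteq> \<Union>\<U>"
    proof
      fix x assume x: "x \<in> U"
      then have xS: "x \<in> S"
        using openin_subset[OF Uo(1)] points_spectrum by blast
      have "\<exists>V \<in> basic ` carrier H. (x \<in> V) \<noteq> (y \<in> V)" if y: "y \<in> points spectrum - U" for y
      proof -
        have yS: "y \<in> S" and "x \<noteq> y"
          using x y points_spectrum by blast+
        then have "(x, y) \<notin> ord spectrum \<or> (y, x) \<notin> ord spectrum"
          using partial_order_onD(3)[OF partial_order_spectrum] by (auto dest: antisymD)
        then show ?thesis
          using ord_separation[OF xS yS] ord_separation[OF yS xS] by blast
      qed
      then obtain V W where VW: "V \<in> basic ` carrier H" "W \<in> basic ` carrier H" "x \<in> V - W" "V - W \<subseteq> U"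
        using basic.basis[OF Uo(1) x] by blast
      have "openin (tau spectrum) (V - W)"
        using VW(1,2) by (intro openin_diff basic.clopen)
      moreover have "down spectrum (V - W) \<in> clopens spectrum"
        using VW(1,2) down_basic_clopen by auto
      ultimately have "V - W \<in> \<U>"
        using VW(4) by (simp add: \<U>_def)
      then show "x \<in> \<Union>\<U>"
        using VW(3) by blast
    qed
  qed
  then obtain D where D: "D \<in> \<U>" "U \<subseteq> D"
    by blast
  then have "D = U"
    by (auto simp: \<U>_def)
  then show ?thesis
    using D(1) by (simp add: \<U>_def)
qed

sublocale spectrum: esakia_space spectrum
proof
  show "\<exists>U \<in> clopen_upsets spectrum. x \<in> U \<and> y \<notin> U"
    if "x \<in> points spectrum" "y \<in> points spectrum" "(x, y) \<notin> ord spectrum" for x y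
    using ord_separation[of x y] that by (simp add: points_spectrum clopen_upsets_spectrum)
qed (fact partial_order_spectrum compact_spectrum down_clopen_spectrum)+

text \<open>Injectivity of \<open>basic\<close> matters here: the element witnessing
  \<open>basic a \<in> eta1 spectrum x\<close> can only be \<open>a\<close>.\<close>

lemma box_of_spectrum:
  assumes a: "a \<in> carrier H"
  shows "box_of spectrum (basic a) = basic (box H a)"
proof -
  have "basic a \<in> eta1 spectrum x \<longleftrightarrow> box H a \<in> e x" for x
    using a inj_on_eq_iff[OF inj_basic] by (auto simp: eta_spectrum)
  then show ?thesis
    by (simp add: box_of_def points_spectrum basic_def)
qed

lemma co_basic_eta2:
  assumes a: "a \<in> carrier H"
  shows "S - basic a \<in> eta2 spectrum x \<longleftrightarrow> dia H a \<notin> e x"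
proof -
  have "S - basic a = S - basic b \<longleftrightarrow> a = b" if "b \<in> carrier H" for b
    using a that basic_subset[of a] basic_subset[of b] inj_on_eq_iff[OF inj_basic a that] by blast
  then show ?thesis
    using a by (auto simp: eta_spectrum)
qed

lemma dia_of_spectrum:
  assumes a: "a \<in> carrier H"
  shows "dia_of spectrum (basic a) = basic (dia H a)"
  using co_basic_eta2[OF a] by (simp add: dia_of_def points_spectrum basic_def)

lemma modal_esakia_spectrum: "modal_esakia_space spectrum"
proof
  fix x assume "x \<in> points spectrum"
  then have x: "x \<in> S"
    by (simp add: points_spectrum)
  show "eta1 spectrum x \<subseteq> clopen_upsets spectrum"
    by (auto simp: eta_spectrum clopen_upsets_spectrum)
  show "eta2 spectrum x \<subseteq> clopen_downsets spectrum"
  proof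
    fix D assume "D \<in> eta2 spectrum x"
    then obtain a where a: "a \<in> carrier H" "D = S - basic a"
      by (auto simp: eta_spectrum)
    have "D = points spectrum - basic a"
      by (simp only: a(2) points_spectrum)
    then have "D \<in> clopens spectrum"
      using basic_clopen[OF a(1)] by (simp add: clopens_def openin_diff closedin_diff)
    moreover have "down spectrum D \<subseteq> D"
      by (auto simp: a(2) down_def ord_spectrum basic_def)
    ultimately show "D \<in> clopen_downsets spectrum"
      by (simp add: clopen_downsets_def)
  qed
  fix U V assume U: "U \<in> clopen_upsets spectrum" "U \<in> eta1 spectrum x" and V: "V \<in> clopen_upsets spectrum"
  obtain a b where a: "a \<in> carrier H" "U = basic a" and b: "b \<in> carrier H" "V = basic b"
    using U(1) V by (auto simp: clopen_upsets_spectrum)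
  have na: "neg H a \<in> carrier H"
    using a by (simp add: neg_def imp_closed)
  have "box H a \<in> e x"
    using box_of_spectrum[OF a(1)] U(2) x a(2) by (auto simp: box_of_def basic_def points_spectrum)
  \<comment> \<open>Otherwise the filter \<open>e x\<close> would contain the meet with
    \<open>box H a\<close>, which is \<open>\<bottom>\<close>.\<close>
  then have "dia H (neg H a \<sqinter> b) \<notin> e x"
    using lattice_filterD(4)[OF e_filter[OF x], of "box H a"] box_dia[OF a(1) b(1)] bottom_e[OF x] by metis
  \<comment> \<open>De Morgan again, with \<open>basic (neg H a)\<close> being the complement of the
    down-set of \<open>U\<close>.\<close>
  moreover have "down spectrum U \<union> (points spectrum - V) = S - basic (neg H a \<sqinter> b)"
    unfolding neg_def basic_meet[OF na[unfolded neg_def] b(1)] basic_imp[OF a(1) bottom_closed] basic_bottom a(2) b(2)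
    using basic_subset by (auto simp: points_spectrum down_def)
  ultimately show "down spectrum U \<union> (points spectrum - V) \<in> eta2 spectrum x"
    using co_basic_eta2[OF meet_closed[OF na b(1)]] by simp
next
  fix U assume "U \<in> clopen_upsets spectrum"
  then show "box_of spectrum U \<in> clopen_upsets spectrum" "dia_of spectrum U \<in> clopen_upsets spectrum"
    by (auto simp: clopen_upsets_spectrum box_of_spectrum dia_of_spectrum box_closed dia_closed)
qed

end

section \<open>The duality\<close>

lemma compose_restrict_id:
  assumes "f \<in> A \<rightarrow>\<^sub>E B"
  shows "compose A f (restrict id A) = f" and "compose A (restrict id B) f = f"
  using assms Id_compose[of f A B] compose_Id[of f A B] unfolding id_def PiE_def by blast+

lemma mh_homD:
  assumes "f \<in> mh_hom H K"
  shows "a \<in> carrier H \<Longrightarrow> f a \<in> carrier K" and "f \<in> carrier H \<rightarrow>\<^sub>E carrier K"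
    and "f \<bottom>\<^bsub>H\<^esub> = \<bottom>\<^bsub>K\<^esub>" and "f \<top>\<^bsub>H\<^esub> = \<top>\<^bsub>K\<^esub>"
    and "\<lbrakk>a \<in> carrier H; b \<in> carrier H\<rbrakk> \<Longrightarrow> f (a \<sqinter>\<^bsub>H\<^esub> b) = f a \<sqinter>\<^bsub>K\<^esub> f b"
    and "\<lbrakk>a \<in> carrier H; b \<in> carrier H\<rbrakk> \<Longrightarrow> f (a \<squnion>\<^bsub>H\<^esub> b) = f a \<squnion>\<^bsub>K\<^esub> f b"
    and "\<lbrakk>a \<in> carrier H; b \<in> carrier H\<rbrakk> \<Longrightarrow> f (imp H a b) = imp K (f a) (f b)"
    and "a \<in> carrier H \<Longrightarrow> f (box H a) = box K (f a)"
    and "a \<in> carrier H \<Longrightarrow> f (dia H a) = dia K (f a)"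
  using assms by (auto simp: mh_hom_def)

lemma mh_homI:
  assumes "f \<in> carrier H \<rightarrow>\<^sub>E carrier K" "f \<bottom>\<^bsub>H\<^esub> = \<bottom>\<^bsub>K\<^esub>" "f \<top>\<^bsub>H\<^esub> = \<top>\<^bsub>K\<^esub>"
    and "\<And>a b. \<lbrakk>a \<in> carrier H; b \<in> carrier H\<rbrakk> \<Longrightarrow> f (a \<sqinter>\<^bsub>H\<^esub> b) = f a \<sqinter>\<^bsub>K\<^esub> f b"
    and "\<And>a b. \<lbrakk>a \<in> carrier H; b \<in> carrier H\<rbrakk> \<Longrightarrow> f (a \<squnion>\<^bsub>H\<^esub> b) = f a \<squnion>\<^bsub>K\<^esub> f b"
    and "\<And>a b. \<lbrakk>a \<in> carrier H; b \<in> carrier H\<rbrakk> \<Longrightarrow> f (imp H a b) = imp K (f a) (f b)"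
    and "\<And>a. a \<in> carrier H \<Longrightarrow> f (box H a) = box K (f a)"
    and "\<And>a. a \<in> carrier H \<Longrightarrow> f (dia H a) = dia K (f a)"
  shows "f \<in> mh_hom H K"
  using assms by (simp add: mh_hom_def)

lemmas (in modal_heyting_algebra) operations_closed =
  bottom_closed top_closed meet_closed join_closed imp_closed box_closed dia_closed

lemma mh_hom_id:
  assumes "modal_heyting_algebra H"
  shows "restrict id (carrier H) \<in> mh_hom H H"
proof -
  interpret modal_heyting_algebra H by fact
  show ?thesis
    by (rule mh_homI) (auto simp: operations_closed)
qed

lemma mh_hom_compose:
  assumes "modal_heyting_algebra H" and f: "f \<in> mh_hom H K" and g: "g \<in> mh_hom K L"
  shows "compose (carrier H) g f \<in> mh_hom H L"
proof -
  interpret modal_heyting_algebra H by fact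
  show ?thesis
    by (rule mh_homI)
      (auto simp: compose_def operations_closed mh_homD(1,3-)[OF f] mh_homD(1,3-)[OF g])
qed

text \<open>Elements of \<open>carrier K\<close> have the form \<open>f a\<close>, so each law for
  \<open>g\<close> is obtained by carrying the operation back through \<open>f\<close> to
  \<open>H\<close>.\<close>

lemma mh_hom_inverse:
  assumes "modal_heyting_algebra H" and f: "f \<in> mh_hom H K" and bij: "bij_betw f (carrier H) (carrier K)"
  defines "g \<equiv> restrict (inv_into (carrier H) f) (carrier K)"
  shows "g \<in> mh_hom K H"
    and "compose (carrier H) g f = restrict id (carrier H)"
    and "compose (carrier K) f g = restrict id (carrier K)"
proof -
  interpret modal_heyting_algebra H by fact
  have K: "carrier K = f ` carrier H" and inj: "inj_on f (carrier H)"
    using bij by (auto simp: bij_betw_def)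
  have gf: "g (f a) = a" if "a \<in> carrier H" for a
    using that inj by (simp add: g_def K)
  note hom = mh_homD(3-)[OF f, symmetric]
  show "g \<in> mh_hom K H"
  proof (rule mh_homI)
    show "g \<in> carrier K \<rightarrow>\<^sub>E carrier H"
      by (auto simp: K gf) (simp add: g_def K)
  qed (auto simp: K hom gf operations_closed)
  show "compose (carrier H) g f = restrict id (carrier H)"
    by (auto simp: compose_def gf fun_eq_iff)
  show "compose (carrier K) f g = restrict id (carrier K)"
    by (auto simp: compose_def gf fun_eq_iff K)
qed

lemma category_MH: "category (MH \<A>)"
proof
  fix H assume "H \<in> Ob (MH \<A>)"
  then show "Idt (MH \<A>) H \<in> Hom (MH \<A>) H H"
    by (simp add: MH_def mh_hom_id)
next
  fix H K L f g assume "H \<in> Ob (MH \<A>)" and fg: "f \<in> Hom (MH \<A>) H K" "g \<in> Hom (MH \<A>) K L"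
  then show "Cmp (MH \<A>) H K L g f \<in> Hom (MH \<A>) H L"
    using fg by (simp add: MH_def mh_hom_compose)
next
  fix H K f assume "f \<in> Hom (MH \<A>) H K"
  then have f: "f \<in> carrier H \<rightarrow>\<^sub>E carrier K"
    by (simp add: MH_def mh_homD(2))
  show "Cmp (MH \<A>) H H K f (Idt (MH \<A>) H) = f"
    by (simp add: MH_def compose_restrict_id[OF f])
  show "Cmp (MH \<A>) H K K (Idt (MH \<A>) K) f = f"
    by (simp add: MH_def compose_restrict_id[OF f])
next
  fix H K L M f g h assume "f \<in> Hom (MH \<A>) H K"
  then have "f \<in> carrier H \<rightarrow> carrier K"
    by (auto simp: MH_def dest: mh_homD(1))
  then show "Cmp (MH \<A>) H K M (Cmp (MH \<A>) K L M h g) f = Cmp (MH \<A>) H L M h (Cmp (MH \<A>) H K L g f)"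
    by (simp add: MH_def compose_assoc)
qed

section \<open>The category of modal Esakia spaces\<close>

lemma esakia_function_id:
  assumes "esakia_space X"
  shows "restrict id (points X) \<in> esakia_functions X X"
proof -
  interpret esakia_space X by fact
  have "continuous_map (tau X) (tau X) (restrict id (points X))"
    using continuous_map_eq[OF continuous_map_id] by fastforce
  moreover have "y \<in> restrict id (points X) ` up X {x}" if "y \<in> up X {restrict id (points X) x}" "x \<in> points X" for x y
    using that by (intro image_eqI[of _ _ y]) (auto simp: up_def)
  ultimately show ?thesis
    unfolding esakia_functions_def using ord_points by auto
qed

lemma esakia_function_compose:
  assumes "esakia_space X" "esakia_space Y" and f: "f \<in> esakia_functions X Y" and g: "g \<in> esakia_functions Y Z"
  shows "compose (points X) g f \<in> esakia_functions X Z"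
proof -
  interpret X: esakia_space X by fact
  interpret Y: esakia_space Y by fact
  let ?gf = "compose (points X) g f"
  have gf: "?gf x = g (f x)" if "x \<in> points X" for x
    using that by (simp add: compose_eq)
  have "continuous_map (tau X) (tau Z) ?gf"
    by (rule continuous_map_eq[OF continuous_map_compose[OF esakia_functionsD(3)[OF f] esakia_functionsD(3)[OF g]]])
      (simp add: gf)
  moreover have "(?gf x, ?gf y) \<in> ord Z" if xy: "(x, y) \<in> ord X" for x y
    using esakia_functionsD(4)[OF g esakia_functionsD(4)[OF f xy]] X.ord_points[OF xy] by (simp add: gf)
  moreover have "up Z {?gf x} \<subseteq> ?gf ` up X {x}" if x: "x \<in> points X" for x
  proof
    fix z assume "z \<in> up Z {?gf x}"
    then have "(g (f x), z) \<in> ord Z" "z \<in> points Z"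
      using x by (auto simp: up_def gf)
    then obtain y where y: "(f x, y) \<in> ord Y" "g y = z"
      using esakia_functionsD(5)[OF g esakia_functionsD(1)[OF f x]] by blast
    then obtain w where w: "(x, w) \<in> ord X" "f w = y"
      using esakia_functionsD(5)[OF f x] Y.ord_points by blast
    have "w \<in> up X {x}" "z = ?gf w"
      using w y X.ord_points[OF w(1)] by (auto simp: up_def gf)
    then show "z \<in> ?gf ` up X {x}"
      by blast
  qed
  moreover have "?gf \<in> points X \<rightarrow>\<^sub>E points Z"
    using esakia_functionsD(1)[OF f] esakia_functionsD(1)[OF g] by (auto simp: compose_def)
  ultimately show ?thesis
    by (simp add: esakia_functions_def)
qed

lemma me_hom_esakia: "f \<in> me_hom X Y \<Longrightarrow> f \<in> esakia_functions X Y"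
  by (simp add: me_hom_def)

lemma me_hom_id:
  assumes "modal_esakia_space X"
  shows "restrict id (points X) \<in> me_hom X X"
proof -
  interpret modal_esakia_space X by fact
  have "restrict id (points X) -` U \<inter> points X = U" if "U \<subseteq> points X" for U
    using that by auto
  moreover have "U \<subseteq> points X" "box_of X U \<subseteq> points X" "dia_of X U \<subseteq> points X" if "U \<in> clopen_upsets X" for U
    using that clopen_upset_subset by (auto simp: box_of_def dia_of_def)
  ultimately show ?thesis
    by (simp add: me_hom_iff[OF esakia_function_id[OF esakia_space_axioms]])
qed

lemma vimage_compose:
  assumes "f \<in> points X \<rightarrow> points Y"
  shows "compose (points X) g f -` U \<inter> points X = f -` (g -` U \<inter> points Y) \<inter> points X"
  using assms by (auto simp: compose_eq)

lemma me_hom_compose: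
  assumes X: "esakia_space X" and Y: "esakia_space Y" and f: "f \<in> me_hom X Y" and g: "g \<in> me_hom Y Z"
  shows "compose (points X) g f \<in> me_hom X Z"
proof -
  note fE = me_hom_esakia[OF f] and gE = me_hom_esakia[OF g]
  have "f \<in> points X \<rightarrow> points Y"
    using esakia_functionsD(1)[OF fE] by blast
  note vim = vimage_compose[OF this, of g]
  show ?thesis
    unfolding me_hom_iff[OF esakia_function_compose[OF X Y fE gE]] vim
    using f g vimage_clopen_upset[OF Y gE] by (simp add: me_hom_iff[OF fE] me_hom_iff[OF gE])
qed

lemma category_ME: "category (ME \<P> \<A>)"
proof
  fix X assume "X \<in> Ob (ME \<P> \<A>)"
  then show "Idt (ME \<P> \<A>) X \<in> Hom (ME \<P> \<A>) X X"
    by (simp add: ME_def me_hom_id)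
next
  fix X Y Z f g assume "X \<in> Ob (ME \<P> \<A>)" "Y \<in> Ob (ME \<P> \<A>)"
    and fg: "f \<in> Hom (ME \<P> \<A>) X Y" "g \<in> Hom (ME \<P> \<A>) Y Z"
  then show "Cmp (ME \<P> \<A>) X Y Z g f \<in> Hom (ME \<P> \<A>) X Z"
    by (auto simp: ME_def modal_esakia_space_def intro: me_hom_compose)
next
  fix X Y f assume "f \<in> Hom (ME \<P> \<A>) X Y"
  then have f: "f \<in> points X \<rightarrow>\<^sub>E points Y"
    by (simp add: ME_def me_hom_esakia esakia_functionsD(2))
  show "Cmp (ME \<P> \<A>) X X Y f (Idt (ME \<P> \<A>) X) = f"
    by (simp add: ME_def compose_restrict_id[OF f])
  show "Cmp (ME \<P> \<A>) X Y Y (Idt (ME \<P> \<A>) Y) f = f"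
    by (simp add: ME_def compose_restrict_id[OF f])
next
  fix X Y Z W f g h assume "f \<in> Hom (ME \<P> \<A>) X Y"
  then have "f \<in> points X \<rightarrow> points Y"
    by (auto simp: ME_def dest: me_hom_esakia esakia_functionsD(1))
  then show "Cmp (ME \<P> \<A>) X Y W (Cmp (ME \<P> \<A>) Y Z W h g) f = Cmp (ME \<P> \<A>) X Z W h (Cmp (ME \<P> \<A>) X Y Z g f)"
    by (simp add: ME_def compose_assoc)
qed

section \<open>The functor of clopen up-sets and its essential surjectivity\<close>

definition encoding :: "'p modal_esakia \<Rightarrow> 'p set \<Rightarrow> 'a" where
  "encoding X = (SOME i. inj_on i (clopen_upsets X))"

definition clopen_functor ::
  "('p modal_esakia, 'p \<Rightarrow> 'p, 'a modal_heyting, 'a \<Rightarrow> 'a) cat_map" where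
  "clopen_functor = \<lparr> on_Ob = (\<lambda>X. clopen_algebra (encoding X) X),
     on_Hom = (\<lambda>X Y. encoded_spaces.pullback X (encoding X) Y (encoding Y)) \<rparr>"

text \<open>Smallness of the clopen up-sets provides an injection into \<open>'a\<close>, so the one
  chosen by \<open>encoding\<close> is injective.\<close>

lemma encoded_object:
  assumes "X \<in> Ob (ME \<P> (\<A> :: 'a set set))"
  shows "encoded_modal_esakia_space X (encoding X :: _ \<Rightarrow> 'a)"
proof -
  have "\<exists>i :: _ \<Rightarrow> 'a. inj_on i (clopen_upsets X)"
    using assms by (auto simp: ME_def small_def lepoll_def)
  then have "inj_on (encoding X :: _ \<Rightarrow> 'a) (clopen_upsets X)"
    unfolding encoding_def by (rule someI_ex)
  then show ?thesis
    using assms by (simp add: ME_def encoded_modal_esakia_space_def encoded_modal_esakia_space_axioms_def)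
qed

lemma clopen_algebra_object:
  assumes X: "X \<in> Ob (ME \<P> (\<A> :: 'a set set))"
  shows "on_Ob clopen_functor X \<in> Ob (MH \<A>)"
proof -
  interpret encoded_modal_esakia_space X "encoding X :: _ \<Rightarrow> 'a"
    by (rule encoded_object[OF X])
  obtain B where "B \<in> \<A>" "clopen_upsets X \<lesssim> B"
    using X by (auto simp: ME_def small_def)
  then have "small \<A> (carrier A)"
    unfolding small_def carrier_A using lepoll_trans[OF image_lepoll] by blast
  then show ?thesis
    by (simp add: MH_def clopen_functor_def modal_heyting_A)
qed

lemma pullback_bij_ME_MH:
  fixes \<A> :: "'a set set"
  assumes X: "X \<in> Ob (ME \<P> \<A>)" and Y: "Y \<in> Ob (ME \<P> \<A>)"
  shows "bij_betw (on_Hom clopen_functor X Y) (Hom (ME \<P> \<A>) X Y)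
    (Hom (opposite (MH \<A>)) (on_Ob clopen_functor X) (on_Ob clopen_functor Y))"
proof -
  interpret encoded_spaces X "encoding X :: _ \<Rightarrow> 'a" Y "encoding Y :: _ \<Rightarrow> 'a"
    by (intro encoded_spaces.intro encoded_object[OF X] encoded_object[OF Y])
  show ?thesis
    using pullback_bij by (simp add: clopen_functor_def ME_def MH_def opposite_def)
qed

lemma cat_functor_clopen:
  "cat_functor (ME \<P> (\<A> :: 'a set set)) (opposite (MH \<A>)) clopen_functor"
proof (intro cat_functor.intro cat_functor_axioms.intro category_ME category_opposite[OF category_MH])
  show "on_Ob clopen_functor X \<in> Ob (opposite (MH \<A>))" if "X \<in> Ob (ME \<P> \<A>)" for X
    using clopen_algebra_object[OF that] by (simp add: opposite_def)
  show "on_Hom clopen_functor X Y f \<in> Hom (opposite (MH \<A>)) (on_Ob clopen_functor X) (on_Ob clopen_functor Y)"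
    if "X \<in> Ob (ME \<P> \<A>)" "Y \<in> Ob (ME \<P> \<A>)" "f \<in> Hom (ME \<P> \<A>) X Y" for X Y f
    using bij_betwE[OF pullback_bij_ME_MH[OF that(1,2)]] that(3) by blast
  show "on_Hom clopen_functor X X (Idt (ME \<P> \<A>) X) = Idt (opposite (MH \<A>)) (on_Ob clopen_functor X)"
    if X: "X \<in> Ob (ME \<P> \<A>)" for X
  proof -
    interpret encoded_spaces X "encoding X :: _ \<Rightarrow> 'a" X "encoding X :: _ \<Rightarrow> 'a"
      by (intro encoded_spaces.intro encoded_object[OF X])
    have "pullback (restrict id (points X)) = restrict id (carrier X.A)"
    proof
      fix a
      show "pullback (restrict id (points X)) a = restrict id (carrier X.A) a"
      proof (cases "a \<in> carrier X.A")
        case True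
        then obtain U where U: "U \<in> clopen_upsets X" "a = encoding X U"
          by (auto simp: X.carrier_A)
        have "restrict id (points X) -` U \<inter> points X = U"
          using clopen_upset_subset[OF U(1)] by auto
        then show ?thesis
          using U by (simp add: pullback_def encode_apply X.carrier_A)
      qed (simp add: pullback_def encode_def X.carrier_A)
    qed
    then show ?thesis
      by (simp add: clopen_functor_def opposite_def MH_def ME_def)
  qed
  show "on_Hom clopen_functor X Z (Cmp (ME \<P> \<A>) X Y Z g f) =
      Cmp (opposite (MH \<A>)) (on_Ob clopen_functor X) (on_Ob clopen_functor Y) (on_Ob clopen_functor Z)
        (on_Hom clopen_functor Y Z g) (on_Hom clopen_functor X Y f)"
    if X: "X \<in> Ob (ME \<P> \<A>)" and Y: "Y \<in> Ob (ME \<P> \<A>)" and Z: "Z \<in> Ob (ME \<P> \<A>)"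
      and f: "f \<in> Hom (ME \<P> \<A>) X Y" and g: "g \<in> Hom (ME \<P> \<A>) Y Z" for X Y Z f g
  proof -
    interpret XY: encoded_spaces X "encoding X :: _ \<Rightarrow> 'a" Y "encoding Y :: _ \<Rightarrow> 'a"
      by (intro encoded_spaces.intro encoded_object[OF X] encoded_object[OF Y])
    interpret YZ: encoded_spaces Y "encoding Y :: _ \<Rightarrow> 'a" Z "encoding Z :: _ \<Rightarrow> 'a"
      by (intro encoded_spaces.intro encoded_object[OF Y] encoded_object[OF Z])
    interpret XZ: encoded_spaces X "encoding X :: _ \<Rightarrow> 'a" Z "encoding Z :: _ \<Rightarrow> 'a"
      by (intro encoded_spaces.intro encoded_object[OF X] encoded_object[OF Z])
    have gE: "g \<in> esakia_functions Y Z" and fE: "f \<in> esakia_functions X Y"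
      using f g by (simp_all add: ME_def me_hom_esakia)
    have vim: "compose (points X) g f -` U \<inter> points X = f -` (g -` U \<inter> points Y) \<inter> points X" for U
      using esakia_functionsD(1)[OF fE] by (intro vimage_compose) blast
    \<comment> \<open>Both factors use the same \<open>encoding Y\<close>, so coding and decoding
      cancel at \<open>Y\<close> and inverse images compose contravariantly.\<close>
    have "XZ.pullback (compose (points X) g f) = compose (carrier YZ.Y.A) (XY.pullback f) (YZ.pullback g)"
    proof
      fix a
      show "XZ.pullback (compose (points X) g f) a = compose (carrier YZ.Y.A) (XY.pullback f) (YZ.pullback g) a"
      proof (cases "a \<in> carrier YZ.Y.A")
        case True
        then obtain U where U: "U \<in> clopen_upsets Z" "a = encoding Z U"
          by (auto simp: YZ.Y.carrier_A)
        have "g -` U \<inter> points Y \<in> clopen_upsets Y"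
          by (rule vimage_clopen_upset[OF XY.Y.esakia_space_axioms gE U(1)])
        then show ?thesis
          using U True unfolding XZ.pullback_def XY.pullback_def YZ.pullback_def vim
          by (simp add: compose_eq XZ.encode_apply YZ.encode_apply XY.encode_apply)
      qed (simp add: XZ.pullback_def XZ.encode_def YZ.Y.carrier_A compose_def)
    qed
    then show ?thesis
      by (simp add: clopen_functor_def opposite_def MH_def ME_def)
  qed
qed

lemma cat_iso_opposite: "cat_iso (opposite C) X Y f \<longleftrightarrow> cat_iso C Y X f"
  by (auto simp: cat_iso_def opposite_def)

text \<open>The power set hypothesis makes room for the points: prime filters are subsets of the
  carrier, hence form a \<open>\<P>\<close>-small set. The isomorphism sends \<open>a\<close> to the
  code of \<open>basic a\<close>.\<close>

lemma clopen_functor_surj: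
  fixes \<A> :: "'a set set" and \<P> :: "'p set set"
  assumes pow: "\<And>A. A \<in> \<A> \<Longrightarrow> small \<P> (Pow A)" and H: "H \<in> Ob (MH \<A>)"
  shows "\<exists>X \<in> Ob (ME \<P> \<A>). \<exists>k. cat_iso (opposite (MH \<A>)) (on_Ob clopen_functor X) H k"
proof -
  interpret modal_heyting_algebra H
    using H by (simp add: MH_def)
  obtain B where B: "B \<in> \<A>" "carrier H \<lesssim> B"
    using H by (auto simp: MH_def small_def)
  obtain P where P: "P \<in> \<P>" "Pow B \<lesssim> P"
    using pow[OF B(1)] by (auto simp: small_def)
  have "prime_filters H \<lesssim> Pow (carrier H)"
    by (rule subset_imp_lepoll) (auto simp: prime_filters_def lattice_filter_def)
  also have "Pow (carrier H) \<lesssim> Pow B"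
    using B(2) unfolding lepoll_def by (blast intro: inj_on_image_Pow image_Pow_mono)
  also note P(2)
  finally obtain g where g: "inj_on g (prime_filters H)" "g ` prime_filters H \<subseteq> P"
    by (auto simp: lepoll_def)
  \<comment> \<open>The labels are the values of the injection \<open>g\<close>, and its inverse
    recovers the prime filters.\<close>
  interpret heyting_spectrum H "g ` prime_filters H" "inv_into (prime_filters H) g"
    by unfold_locales (rule bij_betw_inv_into[OF inj_on_imp_bij_betw[OF g(1)]])
  have "small \<P> (points spectrum)"
    using P(1) subset_imp_lepoll[OF g(2)] by (auto simp: small_def points_spectrum)
  \<comment> \<open>The clopen up-sets are the image of the carrier under \<open>basic\<close>, so
    they are no larger than \<open>H\<close>.\<close>
  moreover have "small \<A> (clopen_upsets spectrum)"
    unfolding small_def clopen_upsets_spectrum using B lepoll_trans[OF image_lepoll] by blast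
  ultimately have X: "spectrum \<in> Ob (ME \<P> \<A>)"
    by (simp add: ME_def modal_esakia_spectrum)
  let ?i = "encoding spectrum :: _ \<Rightarrow> 'a"
  interpret X: encoded_modal_esakia_space spectrum ?i
    by (rule encoded_object[OF X])
  define k where "k = (\<lambda>a \<in> carrier H. ?i (basic a))"
  have carrier: "carrier X.A = ?i ` basic ` carrier H"
    by (simp add: X.carrier_A clopen_upsets_spectrum)
  have "k \<in> mh_hom H X.A"
    by (rule mh_homI)
      (auto simp: k_def carrier operations_closed basic_clopen_upset X.bottom_A X.top_A X.meet_A X.join_A
        X.imp_A X.box_A X.dia_A basic_bottom basic_top basic_meet basic_join basic_imp box_of_spectrum
        dia_of_spectrum points_spectrum simp del: Diff_iff)
  moreover have "bij_betw k (carrier H) (carrier X.A)"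
  proof -
    have "inj_on (?i \<circ> basic) (carrier H)"
      using comp_inj_on[OF inj_basic] X.inj by (simp add: clopen_upsets_spectrum)
    then show ?thesis
      unfolding carrier k_def by (auto simp: bij_betw_def inj_on_def)
  qed
  ultimately have "cat_iso (MH \<A>) H X.A k"
    using mh_hom_inverse[OF modal_heyting_algebra_axioms, of k X.A] unfolding cat_iso_def MH_def by auto
  then show ?thesis
    using X by (auto simp: cat_iso_opposite clopen_functor_def)
qed

theorem theorem19:
  fixes \<A> :: "'a set set" and \<P> :: "'p set set"
  assumes "\<And>A. A \<in> \<A> \<Longrightarrow> small \<P> (Pow A)"
  shows "dually_equivalent (ME \<P> \<A>) (MH \<A>)"
  unfolding dually_equivalent_def
proof (rule equivalent_categoriesI[OF cat_functor_clopen pullback_bij_ME_MH])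
  show "\<exists>X \<in> Ob (ME \<P> \<A>). \<exists>k. cat_iso (opposite (MH \<A>)) (on_Ob clopen_functor X) H k"
    if "H \<in> Ob (opposite (MH \<A>))" for H
    using clopen_functor_surj[OF assms] that by (simp add: opposite_def)
qed

end
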